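(* Let $\mathbf{y}$ be a finite sequence of variables, let $d,m\in\omega$, and let $Y_m$ denote the set of monomials which occur in the general polynomial of degree $m$ with variables $\mathbf{y}$. Let $u_0(\mathbf{y}),u_1(\mathbf{y}),\ldots,u_d(\mathbf{y})$ be such that $u_i(\mathbf{y})\in Y_m$ for each $i=0,\ldots,d$. Let $\mathbf{x}=\langle x_1,\ldots,x_d\rangle$ and let $\phi(\mathbf{x},\mathbf{y})$ be the formula $$u_0(\mathbf{y})+x_1u_1(\mathbf{y})+\cdots+x_du_d(\mathbf{y})\geq 0$$ in the theory of real closed fields. Then $\mathrm{VCm}(\phi)\geq d$ and $\mathrm{VCd}(\phi)=d$, and hence $\mathrm{VCd}_{\mathrm{ind}}(\phi)=\mathrm{VCd}(\phi)$.
   Context: The theory is $T=\mathrm{RCF}=\mathrm{Th}(\mathbb{R})$ in the language of rings (in which $\geq$ is definable), with a large saturated (monster) model $\mathfrak{M}$ with universe $\mathrm{M}$. For $A\subseteq \mathrm{M}^{|\mathbf{y}|}$, $S_\phi(A)$ is the set of $\phi$-types over $A$, i.e. maximal consistent sets of formulas of the form $\pm\phi(\mathbf{x},\mathbf{a})$, $\mathbf{a}\in A$. A type $p\in S_\phi(A)$ is identified with the subset $\{\mathbf{a}\in A:\phi(\mathbf{x},\mathbf{a})\in p\}$ of $A$. For $r\in\mathbb{R}$, $\mathrm{VCd}(\phi)\leq r$ (VC-density at most $r$) means: there is $K\in\omega$ such that for every nonempty finite $A\subseteq\mathrm{M}^{|\mathbf{y}|}$, $|S_\phi(A)|<K\cdot|A|^r$.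 And $\mathrm{VCd}_{\mathrm{ind}}(\phi)\leq r$ means: there is $K\in\omega$ such that for every nonempty finite indiscernible sequence $\bar{\mathbf{b}}=\langle\mathbf{b}_i:i<N\rangle$ of elements of $\mathrm{M}^{|\mathbf{y}|}$, $|S_\phi(\mathrm{range}(\bar{\mathbf{b}}))|<K\cdot N^r$. $\mathrm{VCd}(\phi)$ and $\mathrm{VCd}_{\mathrm{ind}}(\phi)$ are the infima of the respective admissible $r$. For a set $X$, $\mathcal{C}\subseteq\mathcal{P}(X)$ and $A\subseteq X$, let $\mathcal{C}|^A=\{C\cap A:C\in\mathcal{C}\}$. $\mathcal{C}$ is $e$-maximum (on $X$), $e\in\omega$, if for every finite $A\subseteq X$, $|\mathcal{C}|^A|=\binom{|A|}{\leq e}$, where $\binom{n}{\leq k}$ denotes $\sum_{i=0}^k\binom{n}{i}$ if $k<n$ and $2^n$ otherwise. $\mathrm{VCm}(\phi)$ is the maximum $e\in\omega$ such that for some $A\subseteq\mathrm{M}^{|\mathbf{y}|}$ with $|A|=\aleph_0$ there is a family $\mathcal{C}\subseteq S_\phi(A)$, regarded as a set system on $A$, which is $e$-maximum.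
   Formalization: The monomials u_0,…,u_d are assumed pairwise distinct (with d=1, u_0=u_1=1 the formula is 1+x_1≥0 and VCd=0, so the claim fails), and the sequence y is assumed nonempty (otherwise VCm is undefined and VCd is −∞). *)

theory Defs
  imports Complex_Main "HOL-Library.Extended_Real" "HOL-Library.Countable_Set"
begin

unbundle cardinal_syntax

section \<open>First-order logic in the language of rings\<close>

datatype rterm = Var nat | Zero | One | Add rterm rterm | Minus rterm | Mul rterm rterm

datatype fm = Eq rterm rterm | Neg fm | And fm fm | Exists nat fm

fun tval :: "(nat \<Rightarrow> 'a::comm_ring_1) \<Rightarrow> rterm \<Rightarrow> 'a" where
  "tval s (Var i) = s i"
| "tval s Zero = 0"
| "tval s One = 1"
| "tval s (Add t u) = tval s t + tval s u"
| "tval s (Minus t) = - tval s t"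
| "tval s (Mul t u) = tval s t * tval s u"

fun sat :: "(nat \<Rightarrow> 'a::comm_ring_1) \<Rightarrow> fm \<Rightarrow> bool" where
  "sat s (Eq t u) \<longleftrightarrow> tval s t = tval s u"
| "sat s (Neg f) \<longleftrightarrow> \<not> sat s f"
| "sat s (And f g) \<longleftrightarrow> sat s f \<and> sat s g"
| "sat s (Exists v f) \<longleftrightarrow> (\<exists>c. sat (s(v := c)) f)"

fun tvars :: "rterm \<Rightarrow> nat set" where
  "tvars (Var i) = {i}"
| "tvars Zero = {}"
| "tvars One = {}"
| "tvars (Add t u) = tvars t \<union> tvars u"
| "tvars (Minus t) = tvars t"
| "tvars (Mul t u) = tvars t \<union> tvars u"

fun fvars :: "fm \<Rightarrow> nat set" where
  "fvars (Eq t u) = tvars t \<union> tvars u"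
| "fvars (Neg f) = fvars f"
| "fvars (And f g) = fvars f \<union> fvars g"
| "fvars (Exists v f) = fvars f - {v}"

text \<open>The tuple \<open>xs\<close> is substituted for the variables \<open>0, \<dots>, length xs - 1\<close>. The value \<open>0\<close>
  given to the remaining variables never matters, because \<open>holds f xs\<close> is only used for formulas
  whose free variables are below \<open>length xs\<close>.\<close>

definition assign :: "'a::comm_ring_1 list \<Rightarrow> nat \<Rightarrow> 'a" where
  "assign xs i = (if i < length xs then xs ! i else 0)"

definition holds :: "fm \<Rightarrow> 'a::comm_ring_1 list \<Rightarrow> bool" where
  "holds f xs \<longleftrightarrow> sat (assign xs) f"

definition RCF :: "fm set" where
  "RCF = {f. fvars f = {} \<and> holds f ([] :: real list)}"

text \<open>Models are given as types carrying a ring structure.\<close>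

definition models :: "'a::comm_ring_1 itself \<Rightarrow> fm set \<Rightarrow> bool" where
  "models _ T \<longleftrightarrow> (\<forall>f\<in>T. holds f ([] :: 'a list))"

text \<open>A formula over \<open>A\<close> in the single variable \<open>0\<close> is a pair \<open>(f, as)\<close>, where \<open>as\<close> lists the
  parameters from \<open>A\<close> to be substituted for the variables \<open>1, \<dots>, length as\<close> of \<open>f\<close>.\<close>

definition formulas_over :: "'a set \<Rightarrow> (fm \<times> 'a list) set" where
  "formulas_over A = {(f, as). set as \<subseteq> A \<and> fvars f \<subseteq> {..length as}}"

definition saturated :: "'a::comm_ring_1 itself \<Rightarrow> bool" where
  "saturated _ \<longleftrightarrow>
    (\<forall>(A :: 'a set) P. |A| <o |UNIV :: 'a set| \<longrightarrow> P \<subseteq> formulas_over A \<longrightarrow>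
      (\<forall>Q. finite Q \<longrightarrow> Q \<subseteq> P \<longrightarrow> (\<exists>c. \<forall>(f, as)\<in>Q. holds f (c # as))) \<longrightarrow>
      (\<exists>c. \<forall>(f, as)\<in>P. holds f (c # as)))"

text \<open>In a sequence of \<open>q\<close>-tuples \<open>bs\<close>, any two increasing subsequences of the same length satisfy
  the same formulas without parameters.\<close>

definition indiscernible :: "'a::comm_ring_1 list list \<Rightarrow> bool" where
  "indiscernible bs \<longleftrightarrow>
    (\<forall>I J f. sorted_wrt (<) I \<longrightarrow> sorted_wrt (<) J \<longrightarrow> length I = length J \<longrightarrow>
      set I \<subseteq> {..<length bs} \<longrightarrow> set J \<subseteq> {..<length bs} \<longrightarrow>
      fvars f \<subseteq> {..<length (concat (map ((!) bs) I))} \<longrightarrow>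
      (holds f (concat (map ((!) bs) I)) \<longleftrightarrow> holds f (concat (map ((!) bs) J))))"

definition tuples :: "nat \<Rightarrow> 'a list set" where
  "tuples q = {a. length a = q}"


section \<open>Types and densities of a partitioned formula\<close>

text \<open>A partitioned formula \<open>\<phi>(x, y)\<close> with \<open>|x| = p\<close> and \<open>|y| = q\<close> is a formula \<open>\<phi>\<close> whose free
  variables are below \<open>p + q\<close>, the first \<open>p\<close> variables being \<open>x\<close> and the following \<open>q\<close> ones \<open>y\<close>.
  The pairs \<open>(True, a)\<close> and \<open>(False, a)\<close> stand for the instances \<open>\<phi>(x, a)\<close> and \<open>\<not> \<phi>(x, a)\<close>.\<close>

definition consistent :: "fm \<Rightarrow> nat \<Rightarrow> (bool \<times> 'a::comm_ring_1 list) set \<Rightarrow> bool" where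
  "consistent \<phi> p G \<longleftrightarrow>
    (\<forall>F. finite F \<longrightarrow> F \<subseteq> G \<longrightarrow>
      (\<exists>x\<in>tuples p. \<forall>(b, a)\<in>F. (holds \<phi> (x @ a) \<longleftrightarrow> b)))"

definition phi_types ::
    "fm \<Rightarrow> nat \<Rightarrow> 'a::comm_ring_1 list set \<Rightarrow> (bool \<times> 'a list) set set" where
  "phi_types \<phi> p A =
    {G. G \<subseteq> UNIV \<times> A \<and> consistent \<phi> p G \<and>
        (\<forall>H. H \<subseteq> UNIV \<times> A \<longrightarrow> consistent \<phi> p H \<longrightarrow> G \<subseteq> H \<longrightarrow> H = G)}"

definition type_set :: "'a list set \<Rightarrow> (bool \<times> 'a list) set \<Rightarrow> 'a list set" where
  "type_set A G = {a \<in> A. (True, a) \<in> G}"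

definition VCd_le :: "'a::comm_ring_1 itself \<Rightarrow> fm \<Rightarrow> nat \<Rightarrow> nat \<Rightarrow> real \<Rightarrow> bool" where
  "VCd_le _ \<phi> p q r \<longleftrightarrow>
    (\<exists>K::nat. \<forall>A :: 'a list set. A \<subseteq> tuples q \<longrightarrow> finite A \<longrightarrow> A \<noteq> {} \<longrightarrow>
      real (card (phi_types \<phi> p A)) < real K * real (card A) powr r)"

definition VCd_ind_le :: "'a::comm_ring_1 itself \<Rightarrow> fm \<Rightarrow> nat \<Rightarrow> nat \<Rightarrow> real \<Rightarrow> bool" where
  "VCd_ind_le _ \<phi> p q r \<longleftrightarrow>
    (\<exists>K::nat. \<forall>bs :: 'a list list. set bs \<subseteq> tuples q \<longrightarrow> bs \<noteq> [] \<longrightarrow> indiscernible bs \<longrightarrow>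
      real (card (phi_types \<phi> p (set bs))) < real K * real (length bs) powr r)"

definition VCd :: "'a::comm_ring_1 itself \<Rightarrow> fm \<Rightarrow> nat \<Rightarrow> nat \<Rightarrow> ereal" where
  "VCd M \<phi> p q = Inf (ereal ` {r. VCd_le M \<phi> p q r})"

definition VCd_ind :: "'a::comm_ring_1 itself \<Rightarrow> fm \<Rightarrow> nat \<Rightarrow> nat \<Rightarrow> ereal" where
  "VCd_ind M \<phi> p q = Inf (ereal ` {r. VCd_ind_le M \<phi> p q r})"

definition restriction :: "'b set set \<Rightarrow> 'b set \<Rightarrow> 'b set set" where
  "restriction C A = {c \<inter> A | c. c \<in> C}"

definition binom_le :: "nat \<Rightarrow> nat \<Rightarrow> nat" where
  "binom_le n k = (if k < n then \<Sum>i=0..k. n choose i else 2 ^ n)"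

definition maximum_on :: "nat \<Rightarrow> 'b set \<Rightarrow> 'b set set \<Rightarrow> bool" where
  "maximum_on e X C \<longleftrightarrow>
    C \<subseteq> Pow X \<and> (\<forall>A. finite A \<longrightarrow> A \<subseteq> X \<longrightarrow> card (restriction C A) = binom_le (card A) e)"

text \<open>The supremum in \<open>enat\<close> is the maximum whenever the set is nonempty and bounded, and
  \<open>\<infinity>\<close> if the set is unbounded.\<close>

definition VCm :: "'a::comm_ring_1 itself \<Rightarrow> fm \<Rightarrow> nat \<Rightarrow> nat \<Rightarrow> enat" where
  "VCm _ \<phi> p q =
    Sup (enat ` {e. \<exists>(A :: 'a list set) C. A \<subseteq> tuples q \<and> infinite A \<and> countable A \<and>
                      C \<subseteq> type_set A ` phi_types \<phi> p A \<and> maximum_on e A C})"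


section \<open>The formula\<close>

text \<open>The monomials of the general polynomial of degree \<open>m\<close> in \<open>k\<close> variables, given by their
  exponent vectors.\<close>

definition monomials :: "nat \<Rightarrow> nat \<Rightarrow> nat list set" where
  "monomials k m = {e. length e = k \<and> sum_list e \<le> m}"

fun pow_tm :: "rterm \<Rightarrow> nat \<Rightarrow> rterm" where
  "pow_tm t 0 = One"
| "pow_tm t (Suc n) = Mul t (pow_tm t n)"

definition sum_tm :: "rterm list \<Rightarrow> rterm" where
  "sum_tm ts = foldr Add ts Zero"

definition prod_tm :: "rterm list \<Rightarrow> rterm" where
  "prod_tm ts = foldr Mul ts One"

text \<open>The monomial with exponents \<open>e\<close> in the variables \<open>d, d + 1, \<dots>, d + length e - 1\<close>.\<close>

definition mono_tm :: "nat \<Rightarrow> nat list \<Rightarrow> rterm" where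
  "mono_tm d e = prod_tm (map (\<lambda>j. pow_tm (Var (d + j)) (e ! j)) [0..<length e])"

text \<open>\<open>t \<ge> 0\<close> in the language of rings; the variable \<open>v\<close> must not occur in \<open>t\<close>.\<close>

definition nonneg_fm :: "nat \<Rightarrow> rterm \<Rightarrow> fm" where
  "nonneg_fm v t = Exists v (Eq (Mul (Var v) (Var v)) t)"

text \<open>Here \<open>x\<^sub>1, \<dots>, x\<^sub>d\<close> are the variables \<open>0, \<dots>, d - 1\<close>, and the \<open>k\<close> variables \<open>y\<close> are
  \<open>d, \<dots>, d + k - 1\<close>.\<close>

definition ineq_fm :: "nat \<Rightarrow> nat \<Rightarrow> (nat \<Rightarrow> nat list) \<Rightarrow> fm" where
  "ineq_fm d k u = nonneg_fm (d + k)
     (Add (mono_tm d (u 0))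
       (sum_tm (map (\<lambda>i. Mul (Var (i - 1)) (mono_tm d (u i))) [1..<Suc d])))"


section \<open>The formula expresses the inequality\<close>

lemma tval_pow_tm: "tval s (pow_tm t n) = tval s t ^ n"
  by (induction n) auto

lemma tval_sum_tm: "tval s (sum_tm ts) = sum_list (map (tval s) ts)"
  by (induction ts) (auto simp: sum_tm_def)

lemma tval_prod_tm: "tval s (prod_tm ts) = prod_list (map (tval s) ts)"
  by (induction ts) (auto simp: prod_tm_def)

lemma tval_mono_tm: "tval s (mono_tm d e) = (\<Prod>j<length e. s (d + j) ^ (e ! j))"
  unfolding mono_tm_def tval_prod_tm map_map o_def tval_pow_tm tval.simps
  by (simp add: prod.list_conv_set_nth atLeast0LessThan)

lemma nonneg_is_square:
  assumes "models TYPE('a::linordered_field) RCF"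
  shows "(\<exists>z. z * z = c) \<longleftrightarrow> (0 \<le> (c::'a))"
proof
  let ?f = "Neg (Exists 0 (And (Neg (Exists 1 (Eq (Mul (Var 1) (Var 1)) (Var 0))))
                           (Neg (Exists 1 (Eq (Mul (Var 1) (Var 1)) (Minus (Var 0)))))))"
  have "\<exists>z. z * z = r \<or> z * z = - r" for r :: real
    by (rule exI[of _ "sqrt \<bar>r\<bar>"]) (auto simp: abs_if)
  then have "?f \<in> RCF" by (auto simp: RCF_def holds_def)
  then have "holds ?f ([]::'a list)" using assms by (auto simp: models_def)
  then have *: "(\<exists>z. z * z = c) \<or> (\<exists>z. z * z = - c)" by (auto simp: holds_def)
  show "\<exists>z. z * z = c" if "0 \<le> c"
  proof (rule ccontr)
    assume "\<nexists>z. z * z = c"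
    with * obtain z where z: "z * z = - c" by blast
    with that have "c = 0" using zero_le_square[of z] by simp
    then have "0 * 0 = c" by simp
    with \<open>\<nexists>z. z * z = c\<close> show False by blast
  qed
qed auto

lemma fvars_ineq_fm:
  assumes "\<forall>i\<le>d. length (u i) = k"
  shows "fvars (ineq_fm d k u) \<subseteq> {..<d + k}"
proof -
  have p: "tvars (pow_tm t n) \<subseteq> tvars t" for t n by (induction n) auto
  have q: "tvars (prod_tm ts) \<subseteq> (\<Union>t\<in>set ts. tvars t)" for ts
    by (induction ts) (auto simp: prod_tm_def)
  have r: "tvars (sum_tm ts) \<subseteq> (\<Union>t\<in>set ts. tvars t)" for ts
    by (induction ts) (auto simp: sum_tm_def)
  have m: "tvars (mono_tm d (u i)) \<subseteq> {..<d + k}" if "i \<le> d" for i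
  proof -
    have "tvars (mono_tm d (u i)) \<subseteq> (\<Union>j<k. tvars (pow_tm (Var (d + j)) (u i ! j)))"
      unfolding mono_tm_def using q assms that by (force simp: atLeast0LessThan)
    also have "\<dots> \<subseteq> (\<Union>j<k. tvars (Var (d + j)))"
      using p by (rule UN_mono[OF order_refl])
    finally show ?thesis by auto
  qed
  have "tvars (sum_tm (map (\<lambda>i. Mul (Var (i - 1)) (mono_tm d (u i))) [1..<Suc d])) \<subseteq> {..<d + k}"
  proof (rule order_trans[OF r], rule UN_least)
    fix t assume "t \<in> set (map (\<lambda>i. Mul (Var (i - 1)) (mono_tm d (u i))) [1..<Suc d])"
    then obtain i where "i \<in> {1..<Suc d}" "t = Mul (Var (i - 1)) (mono_tm d (u i))"
      unfolding set_map set_upt by blast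
    then show "tvars t \<subseteq> {..<d + k}" using m[of i] by auto
  qed
  then show ?thesis
    using m[of 0] by (auto simp: ineq_fm_def nonneg_fm_def simp del: upt_Suc)
qed

lemma holds_ineq_fm:
  fixes x y :: "'a::linordered_field list"
  assumes "models TYPE('a) RCF" "length x = d" "length y = k" "\<forall>i\<le>d. length (u i) = k"
  shows "holds (ineq_fm d k u) (x @ y) \<longleftrightarrow>
    (\<Prod>j<k. y ! j ^ (u 0 ! j)) + (\<Sum>i=1..d. x ! (i - 1) * (\<Prod>j<k. y ! j ^ (u i ! j))) \<ge> 0"
proof -
  let ?s = "\<lambda>c. (assign (x @ y))(d + k := c)"
  have y: "?s c (d + j) = y ! j" if "j < k" for c j
    using that assms by (auto simp: assign_def nth_append)
  have m: "tval (?s c) (mono_tm d (u i)) = (\<Prod>j<k. y ! j ^ (u i ! j))" if "i \<le> d" for c i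
    unfolding tval_mono_tm using assms that y[of _ c] by (auto intro!: prod.cong)
  have "tval (?s c) (sum_tm (map (\<lambda>i. Mul (Var (i - 1)) (mono_tm d (u i))) [1..<Suc d])) =
      (\<Sum>i=1..d. x ! (i - 1) * (\<Prod>j<k. y ! j ^ (u i ! j)))" for c
  proof -
    have "tval (?s c) (sum_tm (map (\<lambda>i. Mul (Var (i - 1)) (mono_tm d (u i))) [1..<Suc d])) =
       (\<Sum>i\<in>{1..<Suc d}. ?s c (i - 1) * tval (?s c) (mono_tm d (u i)))"
      unfolding tval_sum_tm map_map o_def tval.simps
      by (subst interv_sum_list_conv_sum_set_nat) (simp del: upt_Suc)
    also have "\<dots> = (\<Sum>i=1..d. x ! (i - 1) * (\<Prod>j<k. y ! j ^ (u i ! j)))"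
    proof (rule sum.cong)
      fix i assume "i \<in> {1..d}"
      then have "i - 1 < d" "i \<le> d" by auto
      moreover from this have "?s c (i - 1) = x ! (i - 1)"
        using assms by (auto simp: assign_def nth_append)
      ultimately show "?s c (i - 1) * tval (?s c) (mono_tm d (u i)) =
          x ! (i - 1) * (\<Prod>j<k. y ! j ^ (u i ! j))"
        using m by simp
    qed auto
    finally show ?thesis .
  qed
  then show ?thesis
    by (simp add: holds_def ineq_fm_def nonneg_fm_def m nonneg_is_square[OF assms(1)] del: upt_Suc)
qed

end

theory Submission
  imports Defs "HOL-Library.Ramsey" "HOL-Computational_Algebra.Polynomial"
begin

text \<open>Substituting \<open>y = (t, t ^ M, t ^ M\<^sup>2, \<dots>)\<close> with \<open>M = m + 1\<close> turns the \<open>u\<^sub>i\<close> into powers of \<open>t\<close> with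
  distinct exponents. By Descartes' rule of signs, valid over every ordered field, the hyperplanes
  in \<open>x\<close> belonging to distinct positive \<open>t\<close> are then in general position, so \<open>n\<close> of them cut the
  space into at least \<open>\<Sum>i\<le>d. n choose i\<close> cells. On the other hand \<open>d + 1\<close> affine functions of \<open>d\<close>
  variables never realise all sign patterns, and by Sauer and Shelah the same sum is an upper bound
  for the number of types over any \<open>n\<close> parameters. Hence all types over the points
  given by \<open>t = 1, 2, \<dots>\<close> form a \<open>d\<close>-maximum family. Ramsey's theorem and saturation provide
  arbitrarily long indiscernible sequences of points on the same curve, which shows that the
  bound \<open>n\<^sup>d\<close> is sharp on indiscernible sequences as well.\<close>


section \<open>Linear relations\<close>

text \<open>General position amounts to solving Vandermonde-like systems with arbitrary distinct
  exponents. Such systems can be singular at points of both signs (exponents 0 and 2 at 1 and -1),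
  hence the restriction to positive \<open>t\<close>; and since the field is an arbitrary ordered
  one, the bound on positive roots is read off the coefficients, without Rolle or limits. The
  coefficient of \<open>u 0\<close> is fixed to 1, so there are \<open>d + 1\<close> exponents but
  only \<open>d\<close> free coefficients: at most \<open>d\<close> of the hyperplanes meet in a
  point, and no \<open>d + 1\<close> instances are shattered. This is why the two counts agree. The
  points with \<open>t = 1, 2, ...\<close> are each definable, so no two of them form an
  indiscernible sequence; there they serve only as finite approximations. The lower bound asks for
  nothing but distinct positive parameters, so homogeneity can be imposed on the parameters
  \<open>t\<close> themselves and the points never leave the curve.\<close>

lemma exists_nontrivial_relation:
  fixes v :: "'b \<Rightarrow> 'c \<Rightarrow> 'a::field"
  assumes "finite J" "finite S" "card J < card S"
  shows "\<exists>c. (\<exists>a\<in>S. c a \<noteq> 0) \<and> (\<forall>j\<in>J. (\<Sum>a\<in>S. c a * v a j) = 0)"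
  using assms
proof (induction J arbitrary: S v rule: finite_induct)
  case empty
  then obtain a where "a \<in> S" by fastforce
  then show ?case by (intro exI[of _ "\<lambda>_. 1"]) auto
next
  case (insert j J)
  show ?case
  proof (cases "\<forall>a\<in>S. v a j = 0")
    case True
    have "card J < card S" using insert by simp
    from insert.IH[OF insert.prems(1) this, of v] True show ?thesis by auto
  next
    case False
    then obtain p where p: "p \<in> S" "v p j \<noteq> 0" by blast
    \<comment> \<open>Gaussian elimination with pivot \<open>p\<close>: every \<open>w a\<close>
      vanishes at \<open>j\<close>. In a relation among the \<open>w a\<close> the vector of
      \<open>p\<close> occurs with a forced coefficient, and this is \<open>s\<close>.\<close>
    define w where "w a i = v a i - v a j / v p j * v p i" for a i
    have "card J < card (S - {p})" using insert p by simp
    from insert.IH[OF _ this, of w] insert.prems obtain c where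
      c: "\<exists>a\<in>S - {p}. c a \<noteq> 0" "\<forall>i\<in>J. (\<Sum>a\<in>S - {p}. c a * w a i) = 0" by auto
    define s where "s = - (\<Sum>a\<in>S - {p}. c a * v a j) / v p j"
    have split: "(\<Sum>a\<in>S. (c(p := s)) a * v a i) = s * v p i + (\<Sum>a\<in>S - {p}. c a * v a i)" for i
      using insert.prems(1) p by (simp add: sum.remove)
    have "(\<Sum>a\<in>S. (c(p := s)) a * v a i) = 0" if "i \<in> J" for i
    proof -
      have "(\<Sum>a\<in>S - {p}. c a * w a i) =
          (\<Sum>a\<in>S - {p}. c a * v a i) - (\<Sum>a\<in>S - {p}. c a * v a j) * (v p i / v p j)"
        unfolding w_def sum_distrib_right sum_subtractf[symmetric]
        by (intro sum.cong) (auto simp: algebra_simps)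
      then have "(\<Sum>a\<in>S - {p}. c a * v a i) = (\<Sum>a\<in>S - {p}. c a * v a j) * (v p i / v p j)"
        using bspec[OF c(2) that] by (metis eq_iff_diff_eq_0)
      then show ?thesis unfolding split by (simp add: s_def)
    qed
    moreover have "(\<Sum>a\<in>S. (c(p := s)) a * v a j) = 0"
      unfolding split using p by (simp add: s_def)
    ultimately show ?thesis using c(1) by (intro exI[of _ "c(p := s)"]) auto
  qed
qed

text \<open>The right-hand side joins the columns as one more, indexed by \<open>None\<close>. There
  are then more columns than equations, so some relation holds; injectivity forces the coefficient
  of \<open>None\<close> to be nonzero, and dividing by it solves the system.\<close>

lemma square_system_solvable:
  fixes v :: "'b \<Rightarrow> 'c \<Rightarrow> 'a::field"
  assumes "finite B" "finite J" "card B = card J"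
    and inj: "\<And>x. \<forall>b\<in>B. (\<Sum>j\<in>J. x j * v b j) = 0 \<Longrightarrow> \<forall>j\<in>J. x j = 0"
  shows "\<exists>x. \<forall>b\<in>B. (\<Sum>j\<in>J. x j * v b j) = c b"
proof -
  define S where "S = insert None (Some ` J)"
  define w where "w q b = (case q of None \<Rightarrow> c b | Some j \<Rightarrow> v b j)" for q b
  have S: "finite S" "card B < card S"
    using assms(1-3) by (auto simp: S_def card_image)
  from exists_nontrivial_relation[OF assms(1) S, of w] obtain l where
    l: "\<exists>q\<in>S. l q \<noteq> 0" "\<forall>b\<in>B. (\<Sum>q\<in>S. l q * w q b) = 0" by blast
  have eq: "l None * c b + (\<Sum>j\<in>J. l (Some j) * v b j) = 0" if "b \<in> B" for b
    using l(2) that assms(2) unfolding S_def by (auto simp: sum.reindex w_def)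
  have "l None \<noteq> 0"
  proof
    assume "l None = 0"
    then have "\<forall>j\<in>J. l (Some j) = 0" using eq by (intro inj) auto
    with \<open>l None = 0\<close> l(1) show False by (auto simp: S_def)
  qed
  have "(\<Sum>j\<in>J. - l (Some j) / l None * v b j) = c b" if "b \<in> B" for b
  proof -
    have "(\<Sum>j\<in>J. - l (Some j) / l None * v b j) = - 1 / l None * (\<Sum>j\<in>J. l (Some j) * v b j)"
      unfolding sum_distrib_left by (rule sum.cong) simp_all
    also have "(\<Sum>j\<in>J. l (Some j) * v b j) = - (l None * c b)"
      by (rule minus_unique[OF eq[OF that], symmetric])
    also have "- 1 / l None * - (l None * c b) = c b" using \<open>l None \<noteq> 0\<close> by simp
    finally show ?thesis .
  qed
  then show ?thesis by (intro exI[of _ "\<lambda>j. - l (Some j) / l None"] ballI)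
qed

section \<open>Shattering\<close>

text \<open>Each trace of \<open>F\<close> on \<open>X\<close> lies in \<open>F0 \<union> F1\<close>
  and is counted once; it is counted again exactly when it extends both with and without
  \<open>x\<close>. The identity serves two inductions: the upper bound by shattered sets and the
  lower bound on cells.\<close>

lemma card_eq_link_deletion:
  assumes "finite X" "x \<notin> X" "F \<subseteq> Pow (insert x X)"
  defines "F0 \<equiv> {S\<in>Pow X. S \<in> F}" and "F1 \<equiv> {S\<in>Pow X. insert x S \<in> F}"
  shows "card F = card (F0 \<union> F1) + card (F0 \<inter> F1)"
proof -
  have "inj_on (insert x) F1" using assms(2) by (auto simp: F1_def inj_on_def)
  then have "card (insert x ` F1) = card F1" by (rule card_image)
  moreover have "F = F0 \<union> insert x ` F1"
  proof
    show "F \<subseteq> F0 \<union> insert x ` F1"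
    proof
      fix S assume S: "S \<in> F"
      show "S \<in> F0 \<union> insert x ` F1"
      proof (cases "x \<in> S")
        case True
        then have "insert x (S - {x}) = S" by auto
        with S assms(3) have "S - {x} \<in> F1" by (auto simp: F1_def)
        with \<open>insert x (S - {x}) = S\<close> show ?thesis by (metis UnI2 imageI)
      next
        case False
        with S assms(3) show ?thesis by (auto simp: F0_def)
      qed
    qed
  qed (auto simp: F0_def F1_def)
  moreover have "F0 \<inter> insert x ` F1 = {}" using assms(2) by (auto simp: F0_def)
  moreover have "finite F0" "finite F1" using assms(1) by (auto simp: F0_def F1_def)
  ultimately have "card F = card F0 + card F1" by (simp add: card_Un_disjoint)
  then show ?thesis using card_Un_Int[OF \<open>finite F0\<close> \<open>finite F1\<close>] by simp
qed

definition shatters :: "'b set set \<Rightarrow> 'b set \<Rightarrow> bool" where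
  "shatters F S \<longleftrightarrow> (\<forall>T\<subseteq>S. \<exists>C\<in>F. C \<inter> S = T)"

text \<open>Pajor's form of the Sauer-Shelah lemma, which makes the induction immediate. A set
  shattered by \<open>F0 \<inter> F1\<close> stays shattered by \<open>F\<close> when
  \<open>x\<close> is added, and such sets differ from those obtained from
  \<open>F0 \<union> F1\<close>, which avoid \<open>x\<close>.\<close>

lemma card_le_card_shattered:
  assumes "finite X" "F \<subseteq> Pow X"
  shows "card F \<le> card {S\<in>Pow X. shatters F S}"
  using assms
proof (induction X arbitrary: F rule: finite_induct)
  case empty
  show ?case
  proof (cases "F = {}")
    case False
    then have "F = {{}}" using empty by auto
    moreover have "{S\<in>Pow {}. shatters {{}} S} = {{} :: 'a set}"
      unfolding shatters_def by fastforce
    ultimately show ?thesis by simp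
  qed simp
next
  case (insert x X)
  define F0 where "F0 = {S\<in>Pow X. S \<in> F}"
  define F1 where "F1 = {S\<in>Pow X. insert x S \<in> F}"
  let ?U = "{S\<in>Pow X. shatters (F0 \<union> F1) S}" and ?V = "{S\<in>Pow X. shatters (F0 \<inter> F1) S}"
  have "card F = card (F0 \<union> F1) + card (F0 \<inter> F1)"
    unfolding F0_def F1_def using insert by (intro card_eq_link_deletion) auto
  also have "\<dots> \<le> card ?U + card ?V"
    by (intro add_mono insert.IH) (auto simp: F0_def F1_def)
  also have "card ?V = card (insert x ` ?V)"
    using insert.hyps(2) by (intro card_image[symmetric]) (auto simp: inj_on_def)
  also have "card ?U + card (insert x ` ?V) = card (?U \<union> insert x ` ?V)"
    using insert.hyps by (intro card_Un_disjoint[symmetric]) auto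
  also have "\<dots> \<le> card {S\<in>Pow (insert x X). shatters F S}"
  proof (rule card_mono)
    have "shatters F S" if "S \<subseteq> X" "shatters (F0 \<union> F1) S" for S
      unfolding shatters_def
    proof (intro allI impI)
      fix T assume "T \<subseteq> S"
      with that obtain C where C: "C \<in> F0 \<union> F1" "C \<inter> S = T"
        unfolding shatters_def by blast
      then consider "C \<in> F" | "insert x C \<in> F" by (auto simp: F0_def F1_def)
      then show "\<exists>C\<in>F. C \<inter> S = T"
      proof cases
        case 1
        then show ?thesis using C by blast
      next
        case 2
        have "x \<notin> S" using that insert.hyps(2) by blast
        then have "insert x C \<inter> S = T" using C by blast
        with 2 show ?thesis by blast
      qed
    qed
    moreover have "shatters F (insert x S)" if "S \<subseteq> X" "shatters (F0 \<inter> F1) S" for S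
      unfolding shatters_def
    proof (intro allI impI)
      fix T assume T: "T \<subseteq> insert x S"
      then have "T - {x} \<subseteq> S" by auto
      with that obtain C where C: "C \<in> F0" "C \<in> F1" "C \<inter> S = T - {x}"
        unfolding shatters_def by blast
      show "\<exists>C\<in>F. C \<inter> insert x S = T"
      proof (cases "x \<in> T")
        case True
        with C T show ?thesis
          by (intro bexI[of _ "insert x C"]) (auto simp: F1_def)
      next
        case False
        with C T insert.hyps(2) show ?thesis
          by (intro bexI[of _ C]) (auto simp: F0_def)
      qed
    qed
    ultimately show "?U \<union> insert x ` ?V \<subseteq> {S\<in>Pow (insert x X). shatters F S}" by blast
  qed (use insert.hyps in simp)
  finally show ?case .
qed

section \<open>Binomial sums and the Sauer-Shelah bound\<close>

lemma binom_le_eq_sum: "binom_le n k = (\<Sum>i\<le>k. n choose i)"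
proof (cases "k < n")
  case False
  then have "(\<Sum>i\<le>k. n choose i) = (\<Sum>i\<le>n. n choose i)"
    by (intro sum.mono_neutral_right) auto
  with False show ?thesis by (simp add: binom_le_def choose_row_sum)
qed (simp add: binom_le_def atLeast0AtMost)

text \<open>Shattering passes to subsets, so excluding the size \<open>Suc d\<close> excludes all
  larger ones; only the subsets of size at most \<open>d\<close> are left to count.\<close>

lemma sauer_shelah:
  assumes "finite X" "F \<subseteq> Pow X"
    and "\<And>S. S \<subseteq> X \<Longrightarrow> card S = Suc d \<Longrightarrow> \<not> shatters F S"
  shows "card F \<le> binom_le (card X) d"
proof -
  have sub: "shatters F S'" if "shatters F S" "S' \<subseteq> S" for S S'
    unfolding shatters_def
  proof (intro allI impI)
    fix T assume "T \<subseteq> S'"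
    then have "T \<subseteq> S" using that by simp
    with that(1) obtain C where "C \<in> F" "C \<inter> S = T" unfolding shatters_def by meson
    then show "\<exists>C\<in>F. C \<inter> S' = T" using that \<open>T \<subseteq> S'\<close> by blast
  qed
  have "card S \<le> d" if "S \<subseteq> X" "shatters F S" for S
  proof (rule ccontr)
    assume "\<not> card S \<le> d"
    then have "Suc d \<le> card S" by simp
    then obtain S' where "S' \<subseteq> S" "card S' = Suc d" by (meson obtain_subset_with_card_n)
    with that sub assms(3) show False by (meson order_trans)
  qed
  then have "{S\<in>Pow X. shatters F S} \<subseteq> (\<Union>i\<in>{..d}. {S. S \<subseteq> X \<and> card S = i})" by auto
  then have "card {S\<in>Pow X. shatters F S} \<le> card (\<Union>i\<in>{..d}. {S. S \<subseteq> X \<and> card S = i})"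
    using assms(1) by (intro card_mono) auto
  also have "\<dots> \<le> (\<Sum>i\<le>d. card {S. S \<subseteq> X \<and> card S = i})"
    by (intro card_UN_le) auto
  also have "\<dots> = binom_le (card X) d"
    using assms(1) by (simp add: n_subsets binom_le_eq_sum)
  finally show ?thesis using card_le_card_shattered[OF assms(1,2)] by simp
qed

text \<open>Pascal's rule, summed. The same recursion governs the cells when a hyperplane is
  added.\<close>

lemma binom_le_Suc_Suc: "binom_le (Suc n) (Suc k) = binom_le n (Suc k) + binom_le n k"
  unfolding binom_le_eq_sum by (induction k) auto

lemma binom_le_le_power:
  assumes "n \<ge> 1"
  shows "binom_le n d \<le> Suc d * n ^ d"
proof -
  have "n choose i \<le> n ^ d" if "i \<le> d" for i
  proof (cases "i \<le> n")
    case True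
    then have "n choose i \<le> n ^ i" by (rule binomial_le_pow)
    also have "\<dots> \<le> n ^ d" using assms that by (rule power_increasing[rotated])
    finally show ?thesis .
  qed (simp add: binomial_eq_0)
  then have "(\<Sum>i\<le>d. n choose i) \<le> (\<Sum>i\<le>d. n ^ d)" by (intro sum_mono) auto
  then show ?thesis by (simp add: binom_le_eq_sum)
qed

section \<open>Positive roots over ordered fields\<close>

text \<open>At least \<open>n\<close> sign changes among the coefficients. The factor
  \<open>r\<close> absorbs the sign of the first one, so a shift of the pattern by one place only
  replaces \<open>r\<close> by \<open>- r\<close>.\<close>

definition alternates :: "'a::linordered_idom poly \<Rightarrow> nat \<Rightarrow> bool" where
  "alternates p n \<longleftrightarrow> (\<exists>r i. r \<noteq> 0 \<and> strict_mono_on {..n} i \<and>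
     (\<forall>j\<le>n. 0 < r * (-1) ^ j * coeff p (i j)))"

text \<open>The sums \<open>\<Sum>l<h. a ^ l * coeff p l\<close> of the product \<open>p\<close> telescope to
  \<open>- (a ^ h * coeff q (h - 1))\<close>. Between two alternations of \<open>q\<close> they therefore change in a known
  direction, and so does some coefficient of \<open>p\<close>; the start and the end together give one more.\<close>

lemma alternates_mult_linear:
  fixes q :: "'a::linordered_idom poly"
  assumes "alternates q n" "0 < a"
  shows "alternates ([:- a, 1:] * q) (Suc n)"
proof -
  obtain r i where r: "r \<noteq> 0" and i: "strict_mono_on {..n} i"
    and pos: "\<And>j. j \<le> n \<Longrightarrow> 0 < r * (-1) ^ j * coeff q (i j)"
    using assms(1) unfolding alternates_def by blast
  define p where "p = [:- a, 1:] * q"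
  define P where "P h = (\<Sum>l<h. a ^ l * coeff p l)" for h
  have P_Suc: "P (Suc h) = - (a ^ Suc h * coeff q h)" for h
    by (induction h) (auto simp: P_def p_def coeff_pCons algebra_simps)
  \<comment> \<open>Cut points for the partial sums: the inner ones lie just past the alternation
    points of \<open>q\<close>, the last one beyond the degree of \<open>q\<close>, where the sum
    vanishes as it does at 0. Adding \<open>i n\<close> there keeps the cuts increasing.\<close>
  define h where "h j = (if j = 0 then 0 else if j \<le> Suc n then Suc (i (j - 1))
      else Suc (Suc (i n + degree q)))" for j
  \<comment> \<open>Since the sign \<open>(-1) ^ j\<close> flips at each step,
    \<open>E (Suc j) + E j\<close> is, up to the factor \<open>(- r) * (-1) ^ j\<close>, the sum
    over the block between two cuts. Its positivity forces a term of the right sign in the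
    block.\<close>
  define E where "E j = r * (-1) ^ j * P (h j)" for j
  have E0: "E 0 = 0" by (simp add: E_def h_def P_def)
  have En: "E (Suc (Suc n)) = 0" by (simp add: E_def h_def P_Suc coeff_eq_0)
  have Ej: "0 < E j" if j: "j \<in> {1..Suc n}" for j
  proof -
    obtain l where l: "j = Suc l" "l \<le> n" using j by (cases j) auto
    have "0 < a ^ Suc (i l) * (r * (-1) ^ l * coeff q (i l))"
      by (rule mult_pos_pos[OF zero_less_power[OF assms(2)] pos[OF l(2)]])
    also have "\<dots> = E j" using l by (simp add: E_def h_def P_Suc)
    finally show ?thesis .
  qed
  have Esum: "0 < E (Suc j) + E j" if "j \<le> Suc n" for j
    using that Ej[of j] Ej[of "Suc j"] E0 En
    by (cases "j = 0"; cases "j = Suc n") auto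
  have h_mono: "h j \<le> h (Suc j)" if j: "j \<le> Suc n" for j
  proof -
    consider "j = 0" | l where "j = Suc l" "l < n" | "j = Suc n" using j
      by (metis Suc_le_mono le_neq_implies_less not0_implies_Suc)
    then show ?thesis
    proof cases
      case 2
      then have "i l < i (Suc l)" using i by (auto simp: strict_mono_on_def)
      with 2 show ?thesis by (auto simp: h_def)
    qed (auto simp: h_def)
  qed
  have "\<exists>l\<in>{h j..<h (Suc j)}. 0 < (- r) * (-1) ^ j * coeff p l" if j: "j \<le> Suc n" for j
  proof (rule ccontr)
    assume "\<not> ?thesis"
    then have neg: "(- r) * (-1) ^ j * coeff p l \<le> 0" if "l \<in> {h j..<h (Suc j)}" for l
      using that by force
    have "P (h (Suc j)) = P (h j) + (\<Sum>l\<in>{h j..<h (Suc j)}. a ^ l * coeff p l)"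
      unfolding P_def lessThan_atLeast0 using h_mono[OF j] by (simp add: sum.atLeastLessThan_concat)
    then have "E (Suc j) + E j = (- r) * (-1) ^ j * (\<Sum>l\<in>{h j..<h (Suc j)}. a ^ l * coeff p l)"
      by (simp add: E_def algebra_simps)
    also have "\<dots> = (\<Sum>l\<in>{h j..<h (Suc j)}. a ^ l * ((- r) * (-1) ^ j * coeff p l))"
      unfolding sum_distrib_left by (intro sum.cong) (auto simp: algebra_simps)
    also have "\<dots> \<le> 0"
      using assms(2) by (intro sum_nonpos mult_nonneg_nonpos[OF _ neg]) auto
    finally show False using Esum[OF j] by simp
  qed
  then obtain i' where i': "\<And>j. j \<le> Suc n \<Longrightarrow> i' j \<in> {h j..<h (Suc j)}"
    and pos': "\<And>j. j \<le> Suc n \<Longrightarrow> 0 < (- r) * (-1) ^ j * coeff p (i' j)"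
    by metis
  have "i' j < i' l" if "j < l" "l \<le> Suc n" for j l
  proof -
    have "h (Suc j) \<le> h l"
      using that h_mono
    proof (induction l)
      case (Suc l)
      then show ?case
        by (cases "j = l") (auto intro: order_trans less_imp_le_nat simp: less_Suc_eq)
    qed simp
    moreover have "i' j < h (Suc j)" "h l \<le> i' l" using i'[of j] i'[of l] that by auto
    ultimately show ?thesis by simp
  qed
  then have "strict_mono_on {..Suc n} i'" by (auto simp: strict_mono_on_def)
  then show ?thesis using r pos' unfolding alternates_def p_def[symmetric]
    by (intro exI[of _ "- r"] exI[of _ i']) auto
qed

text \<open>Descartes' rule as a lower bound on sign changes: each positive root splits off a linear
  factor, and each such factor adds one alternation.\<close>

lemma alternates_card_roots:
  fixes p :: "'a::linordered_idom poly"
  assumes "finite B" "p \<noteq> 0" "\<And>b. b \<in> B \<Longrightarrow> 0 < b \<and> poly p b = 0"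
  shows "alternates p (card B)"
  using assms
proof (induction B arbitrary: p rule: finite_induct)
  case empty
  have "strict_mono_on {..0::nat} (\<lambda>_. degree p)" by (auto simp: strict_mono_on_def)
  moreover have "0 < lead_coeff p * lead_coeff p" using empty by (simp add: less_le)
  ultimately show ?case using empty unfolding alternates_def
    by (intro exI[of _ "lead_coeff p"] exI[of _ "\<lambda>_. degree p"]) simp
next
  case (insert b B)
  then obtain q where q: "p = [:- b, 1:] * q" by (metis dvdE insertI1 poly_eq_0_iff_dvd)
  have "0 < c \<and> poly q c = 0" if "c \<in> B" for c
    using insert.prems(2)[of c] insert.hyps(2) that q by auto
  then have "alternates q (card B)" using insert.prems q by (intro insert.IH) auto
  then have "alternates p (Suc (card B))"
    unfolding q using insert.prems(2) by (intro alternates_mult_linear) auto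
  then show ?case using insert.hyps by simp
qed

text \<open>A nonzero polynomial with \<open>card B\<close> positive roots has
  \<open>card B + 1\<close> alternating, hence nonzero, coefficients, but only \<open>card J\<close>
  monomials are available. Equivalently, generalised Vandermonde matrices at distinct positive
  points are nonsingular.\<close>

lemma positive_roots_less_terms:
  fixes x :: "'j \<Rightarrow> 'a::linordered_idom"
  assumes "finite J" "inj_on e J" "finite B" "card J \<le> card B"
    and "\<And>b. b \<in> B \<Longrightarrow> 0 < b \<and> (\<Sum>j\<in>J. x j * b ^ e j) = 0"
  shows "\<forall>j\<in>J. x j = 0"
proof (rule ccontr)
  assume "\<not> ?thesis"
  then obtain j where j: "j \<in> J" "x j \<noteq> 0" by blast
  define p where "p = (\<Sum>j\<in>J. monom (x j) (e j))"
  have coeff: "coeff p l = (\<Sum>j\<in>J. if e j = l then x j else 0)" for l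
    by (simp add: p_def coeff_sum)
  have "coeff p (e j) = (\<Sum>i\<in>{j}. if e i = e j then x i else 0)"
    unfolding coeff using assms(1,2) j by (intro sum.mono_neutral_right) (auto dest: inj_onD)
  with j have "p \<noteq> 0" by auto
  moreover have "poly p b = (\<Sum>j\<in>J. x j * b ^ e j)" for b
    by (simp add: p_def poly_sum poly_monom)
  ultimately have "alternates p (card B)"
    using assms(3,5) by (intro alternates_card_roots) auto
  then obtain r i where i: "strict_mono_on {..card B} i"
    and pos: "\<And>j. j \<le> card B \<Longrightarrow> 0 < r * (-1) ^ j * coeff p (i j)"
    unfolding alternates_def by blast
  have "i ` {..card B} \<subseteq> e ` J"
  proof
    fix l assume "l \<in> i ` {..card B}"
    then have "coeff p l \<noteq> 0" using pos by force
    moreover have "coeff p l = 0" if "l \<notin> e ` J"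
      unfolding coeff using that by (intro sum.neutral) auto
    ultimately show "l \<in> e ` J" by blast
  qed
  then have "card (i ` {..card B}) \<le> card (e ` J)" using assms(1) by (intro card_mono) auto
  also have "\<dots> \<le> card J" using assms(1) by (rule card_image_le)
  also have "card (i ` {..card B}) = Suc (card B)"
    using strict_mono_on_imp_inj_on[OF i] by (simp add: card_image)
  finally show False using assms(4) by simp
qed

section \<open>Cells of the arrangement\<close>

text \<open>The left-hand side of the inequality along the curve. For fixed \<open>t\<close> it is
  affine in \<open>x 1, ..., x d\<close>, and its zero set is the hyperplane belonging to
  \<open>t\<close>.\<close>

definition sparse :: "nat \<Rightarrow> (nat \<Rightarrow> nat) \<Rightarrow> (nat \<Rightarrow> 'a) \<Rightarrow> 'a \<Rightarrow> 'a::comm_ring_1" where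
  "sparse d e x t = t ^ e 0 + (\<Sum>i=1..d. x i * t ^ e i)"

lemma sparse_shift: "sparse d e (\<lambda>i. x i + c * z i) t = sparse d e x t + c * (\<Sum>i=1..d. z i * t ^ e i)"
  by (simp add: sparse_def sum_distrib_left sum.distrib algebra_simps)

text \<open>Only the first \<open>card B\<close> exponents are used, which gives a square system;
  its injectivity is the bound on positive roots. The remaining coefficients are set to 0.\<close>

lemma sparse_interpolation:
  fixes c :: "'a::linordered_field \<Rightarrow> 'a"
  assumes "inj_on e {0..d}" "finite B" "card B \<le> d" "\<And>b. b \<in> B \<Longrightarrow> 0 < b"
  shows "\<exists>z. \<forall>b\<in>B. (\<Sum>i=1..d. z i * b ^ e i) = c b"
proof -
  let ?J = "{1..card B}"
  have inj: "inj_on e ?J" using assms(3) by (intro inj_on_subset[OF assms(1)]) auto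
  have "\<exists>z. \<forall>b\<in>B. (\<Sum>j\<in>?J. z j * b ^ e j) = c b"
  proof (rule square_system_solvable)
    fix x :: "nat \<Rightarrow> 'a"
    assume "\<forall>b\<in>B. (\<Sum>j\<in>?J. x j * b ^ e j) = 0"
    then show "\<forall>j\<in>?J. x j = 0"
      using inj assms by (intro positive_roots_less_terms[of ?J e B]) auto
  qed (use assms in auto)
  then obtain z where z: "\<And>b. b \<in> B \<Longrightarrow> (\<Sum>j\<in>?J. z j * b ^ e j) = c b" by blast
  have "(\<Sum>i=1..d. (if i \<in> ?J then z i else 0) * b ^ e i) = (\<Sum>i\<in>?J. z i * b ^ e i)" for b
    using assms(3) by (intro sum.mono_neutral_cong_right) auto
  with z show ?thesis by (intro exI[of _ "\<lambda>i. if i \<in> ?J then z i else 0"]) auto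
qed

lemma card_sparse_roots_le:
  fixes x :: "nat \<Rightarrow> 'a::linordered_field"
  assumes "inj_on e {0..d}" "finite B" "\<And>b. b \<in> B \<Longrightarrow> 0 < b \<and> sparse d e x b = 0"
  shows "card B \<le> d"
proof (rule ccontr)
  assume *: "\<not> card B \<le> d"
  \<comment> \<open>The fixed coefficient becomes entry 0. More than \<open>d\<close> roots would
    annihilate all \<open>d + 1\<close> entries, including this 1.\<close>
  let ?x = "x(0 := 1)"
  have eq: "(\<Sum>i\<in>{0..d}. ?x i * b ^ e i) = sparse d e x b" for b
  proof -
    have "(\<Sum>i\<in>{0..d}. ?x i * b ^ e i) = ?x 0 * b ^ e 0 + (\<Sum>i=1..d. ?x i * b ^ e i)"
      by (subst sum.atLeast_Suc_atMost) auto
    also have "(\<Sum>i=1..d. ?x i * b ^ e i) = (\<Sum>i=1..d. x i * b ^ e i)"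
      by (intro sum.cong) auto
    finally show ?thesis by (simp add: sparse_def)
  qed
  have "0 < b \<and> (\<Sum>i\<in>{0..d}. ?x i * b ^ e i) = 0" if "b \<in> B" for b
    unfolding eq using that by (rule assms(3))
  then have "\<forall>j\<in>{0..d}. ?x j = 0"
    using assms(1,2) * by (intro positive_roots_less_terms[of "{0..d}" e B]) auto
  then have "?x 0 = 0" by (rule bspec) simp
  then show False by simp
qed

text \<open>Stands in for continuity: finitely many strict inequalities survive a small enough
  perturbation.\<close>

lemma small_multiple_exists:
  fixes l h :: "'b \<Rightarrow> 'a::linordered_field"
  assumes "finite A" "\<And>a. a \<in> A \<Longrightarrow> 0 < h a"
  shows "\<exists>\<epsilon>>0. \<forall>a\<in>A. \<epsilon> * \<bar>l a\<bar> < h a"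
  using assms
proof (induction A rule: finite_induct)
  case empty
  show ?case by (intro exI[of _ 1]) auto
next
  case (insert a A)
  then obtain \<epsilon> where \<epsilon>: "\<epsilon> > 0" "\<And>b. b \<in> A \<Longrightarrow> \<epsilon> * \<bar>l b\<bar> < h b" by auto
  \<comment> \<open>The summand 1 keeps the quotient defined when \<open>l a = 0\<close>.\<close>
  define \<delta> where "\<delta> = min \<epsilon> (h a / (\<bar>l a\<bar> + 1))"
  have a: "0 < h a" "0 < \<bar>l a\<bar> + 1" using insert.prems[of a] by (auto intro: add_nonneg_pos)
  then have "\<delta> > 0" using \<epsilon> by (auto simp: \<delta>_def)
  moreover have "\<delta> * \<bar>l b\<bar> < h b" if "b \<in> A" for b
  proof -
    have "\<delta> * \<bar>l b\<bar> \<le> \<epsilon> * \<bar>l b\<bar>" by (intro mult_right_mono) (auto simp: \<delta>_def)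
    with \<epsilon>(2)[OF that] show ?thesis by simp
  qed
  moreover have "\<delta> * \<bar>l a\<bar> < h a"
  proof -
    have "\<delta> * \<bar>l a\<bar> < \<delta> * (\<bar>l a\<bar> + 1)" using \<open>\<delta> > 0\<close> by simp
    also have "\<dots> \<le> h a / (\<bar>l a\<bar> + 1) * (\<bar>l a\<bar> + 1)"
      using a by (intro mult_right_mono) (auto simp: \<delta>_def)
    also have "\<dots> = h a" using a by simp
    finally show ?thesis .
  qed
  ultimately show ?case by auto
qed

text \<open>The sign patterns on \<open>A\<close> of the open cells inside the flat cut out by \<open>B\<close>.\<close>

definition cells :: "nat \<Rightarrow> (nat \<Rightarrow> nat) \<Rightarrow> 'a::linordered_field set \<Rightarrow> 'a set \<Rightarrow> 'a set set" where
  "cells d e B A = {{a\<in>A. 0 < sparse d e x a} | x.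
     (\<forall>b\<in>B. sparse d e x b = 0) \<and> (\<forall>a\<in>A. sparse d e x a \<noteq> 0)}"

lemma cells_eqI:
  assumes "\<forall>b\<in>B. sparse d e x b = 0" "\<forall>a\<in>A. sparse d e x a \<noteq> 0"
    and "S = {a\<in>A. 0 < sparse d e x a}"
  shows "S \<in> cells d e B A"
  using assms unfolding cells_def by blast

text \<open>A cell inside the hyperplane of \<open>a\<close> is pushed off to both sides. The
  direction \<open>z\<close> has linear part 1 at \<open>a\<close> and 0 on \<open>B\<close>, so the
  flat of \<open>B\<close> is not left; it exists because \<open>insert a B\<close> has at most
  \<open>d\<close> points. A small step preserves the signs on \<open>A\<close>.\<close>

lemma cells_perturb:
  fixes A B :: "'a::linordered_field set"
  assumes "inj_on e {0..d}" "finite A" "finite B" "card (insert a B) \<le> d" "a \<notin> B"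
    and pos: "\<And>b. b \<in> insert a B \<Longrightarrow> 0 < b"
    and x: "\<forall>b\<in>insert a B. sparse d e x b = 0" "\<forall>b\<in>A. sparse d e x b \<noteq> 0"
    and "a \<notin> A"
  shows "{b\<in>A. 0 < sparse d e x b} \<in> cells d e B (insert a A)"
    and "insert a {b\<in>A. 0 < sparse d e x b} \<in> cells d e B (insert a A)"
proof -
  obtain z where z: "\<And>b. b \<in> insert a B \<Longrightarrow> (\<Sum>i=1..d. z i * b ^ e i) = (if b = a then 1 else 0)"
    using sparse_interpolation[OF assms(1) _ assms(4) pos, of "\<lambda>b. if b = a then 1 else 0"]
      assms(3) by (metis finite_insert)
  define l where "l b = (\<Sum>i=1..d. z i * b ^ e i)" for b
  obtain \<epsilon> where \<epsilon>: "\<epsilon> > 0" "\<And>b. b \<in> A \<Longrightarrow> \<epsilon> * \<bar>l b\<bar> < \<bar>sparse d e x b\<bar>"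
    using small_multiple_exists[of A "\<lambda>b. \<bar>sparse d e x b\<bar>" l] assms(2) x(2) by auto
  define X where "X \<sigma> i = x i + \<sigma> * \<epsilon> * z i" for \<sigma> i
  have X: "sparse d e (X \<sigma>) b = sparse d e x b + \<sigma> * \<epsilon> * l b" for \<sigma> b
    unfolding X_def sparse_shift l_def ..
  have on_B: "\<forall>b\<in>B. sparse d e (X \<sigma>) b = 0" for \<sigma>
    using x(1) z assms(5) unfolding X l_def by auto
  have at_a: "sparse d e (X \<sigma>) a = \<sigma> * \<epsilon>" for \<sigma>
    using x(1) z unfolding X l_def by simp
  have on_A: "sparse d e (X \<sigma>) b \<noteq> 0 \<and> (0 < sparse d e (X \<sigma>) b \<longleftrightarrow> 0 < sparse d e x b)"
    if "b \<in> A" "\<sigma> \<in> {1, -1}" for \<sigma> b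
  proof -
    have "\<bar>\<sigma> * \<epsilon> * l b\<bar> < \<bar>sparse d e x b\<bar>" using \<epsilon> that by (auto simp: abs_mult)
    then show ?thesis unfolding X by linarith
  qed
  show "{b\<in>A. 0 < sparse d e x b} \<in> cells d e B (insert a A)"
  proof (rule cells_eqI[OF on_B[of "-1"]])
    have "sparse d e (X (-1)) a < 0" using at_a[of "-1"] \<epsilon>(1) by simp
    then show "\<forall>b\<in>insert a A. sparse d e (X (-1)) b \<noteq> 0"
      and "{b\<in>A. 0 < sparse d e x b} = {b\<in>insert a A. 0 < sparse d e (X (-1)) b}"
      using on_A[of _ "-1"] by auto
  qed
  show "insert a {b\<in>A. 0 < sparse d e x b} \<in> cells d e B (insert a A)"
  proof (rule cells_eqI[OF on_B[of 1]])
    have "0 < sparse d e (X 1) a" using at_a[of 1] \<epsilon>(1) by simp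
    then show "\<forall>b\<in>insert a A. sparse d e (X 1) b \<noteq> 0"
      and "insert a {b\<in>A. 0 < sparse d e x b} = {b\<in>insert a A. 0 < sparse d e (X 1) b}"
      using on_A[of _ 1] by auto
  qed
qed

text \<open>Deletion and restriction: a new hyperplane splits at least those cells that contain a cell of the
  arrangement induced on it.\<close>

lemma binom_le_le_card_cells:
  fixes A B :: "'a::linordered_field set"
  assumes "inj_on e {0..d}" "finite A" "finite B" "A \<inter> B = {}" "card B \<le> d"
    and "\<And>t. t \<in> A \<union> B \<Longrightarrow> 0 < t"
  shows "binom_le (card A) (d - card B) \<le> card (cells d e B A)"
  using assms(2-6)
proof (induction A arbitrary: B rule: finite_induct)
  case empty
  have "\<And>b. b \<in> B \<Longrightarrow> 0 < b" using empty(4) by simp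
  from sparse_interpolation[OF assms(1) empty(1,3) this, of "\<lambda>b. - (b ^ e 0)"]
  obtain x :: "nat \<Rightarrow> 'a" where "\<forall>b\<in>B. (\<Sum>i=1..d. x i * b ^ e i) = - (b ^ e 0)" by meson
  then have "{} \<in> cells d e B {}" by (intro cells_eqI[of _ _ _ x]) (auto simp: sparse_def)
  moreover have "cells d e B {} \<subseteq> {{}}" by (auto simp: cells_def)
  ultimately have "cells d e B {} = {{}}" by blast
  then show ?case by (simp add: binom_le_def)
next
  case (insert a A)
  have fin: "finite (cells d e B A)" if "finite A" for A B :: "'a set"
    by (rule finite_subset[of _ "Pow A"]) (use that in \<open>auto simp: cells_def\<close>)
  show ?case
  proof (cases "card B = d")
    \<comment> \<open>The flat of \<open>B\<close> has dimension 0: a point on \<open>d\<close>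
      hyperplanes lies on no further one, so it forms the single cell required.\<close>
    case True
    have "\<And>b. b \<in> B \<Longrightarrow> 0 < b" using insert.prems(4) by simp
    from sparse_interpolation[OF assms(1) insert.prems(1,3) this, of "\<lambda>b. - (b ^ e 0)"]
    obtain x :: "nat \<Rightarrow> 'a" where "\<forall>b\<in>B. (\<Sum>i=1..d. x i * b ^ e i) = - (b ^ e 0)" by meson
    then have x: "\<forall>b\<in>B. sparse d e x b = 0" by (auto simp: sparse_def)
    have "\<forall>b\<in>insert a A. sparse d e x b \<noteq> 0"
    proof (intro ballI notI)
      fix b assume b: "b \<in> insert a A" "sparse d e x b = 0"
      then have "card (insert b B) \<le> d"
        using x insert.prems by (intro card_sparse_roots_le[OF assms(1), of _ x]) auto
      moreover have "b \<notin> B" using b insert.prems(2) by auto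
      ultimately show False using True insert.prems(1) by simp
    qed
    from cells_eqI[OF x this refl] have "cells d e B (insert a A) \<noteq> {}" by blast
    then have "card (cells d e B (insert a A)) \<ge> 1"
      using fin[of "insert a A" B] insert.hyps(1) by (simp add: Suc_leI card_gt_0_iff)
    with True show ?thesis by (simp add: binom_le_eq_sum)
  next
    case False
    with insert.prems obtain n where n: "d - card B = Suc n" "d - card (insert a B) = n"
      by (cases "d - card B") auto
    have a: "a \<notin> B" "card (insert a B) \<le> d" using False insert.prems by auto
    define F where "F = cells d e B (insert a A)"
    define F0 where "F0 = {S\<in>Pow A. S \<in> F}"
    define F1 where "F1 = {S\<in>Pow A. insert a S \<in> F}"
    have both: "S \<in> F0 \<inter> F1" if cell: "S \<in> cells d e (insert a B) A" for S
    proof -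
      obtain x where x: "\<forall>b\<in>insert a B. sparse d e x b = 0" "\<forall>b\<in>A. sparse d e x b \<noteq> 0"
        and S: "S = {b\<in>A. 0 < sparse d e x b}"
        using cell unfolding cells_def by blast
      show ?thesis
        using cells_perturb[OF assms(1) insert.hyps(1) insert.prems(1) a(2,1) _ x insert.hyps(2)]
          insert.prems(4) unfolding F0_def F1_def F_def S by auto
    qed
    have one: "S \<in> F0 \<union> F1" if cell: "S \<in> cells d e B A" for S
    proof -
      obtain x where x: "\<forall>b\<in>B. sparse d e x b = 0" "\<forall>b\<in>A. sparse d e x b \<noteq> 0"
        and S: "S = {b\<in>A. 0 < sparse d e x b}"
        using cell unfolding cells_def by blast
      consider "sparse d e x a = 0" | "sparse d e x a < 0" | "sparse d e x a > 0"
        by (meson linorder_cases)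
      then show ?thesis
      proof cases
        \<comment> \<open>The chosen point of the cell may happen to lie on the new hyperplane; it
          then represents a cell of the induced arrangement, which extends to both sides.\<close>
        case 1
        with x S have "S \<in> cells d e (insert a B) A" by (intro cells_eqI) auto
        with both show ?thesis by blast
      next
        case 2
        with x S have "S \<in> F" unfolding F_def by (intro cells_eqI[of _ _ _ x]) auto
        with S show ?thesis by (auto simp: F0_def)
      next
        case 3
        with x S have "insert a S \<in> F" unfolding F_def by (intro cells_eqI[of _ _ _ x]) auto
        with S show ?thesis by (auto simp: F1_def)
      qed
    qed
    have finF: "finite F0" "finite F1" using insert.hyps by (auto simp: F0_def F1_def)
    have "binom_le (card (insert a A)) (d - card B) = binom_le (card A) (Suc n) + binom_le (card A) n"
      using insert.hyps n by (simp add: binom_le_Suc_Suc)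
    also have "\<dots> \<le> card (cells d e B A) + card (cells d e (insert a B) A)"
      using insert.IH[of B] insert.IH[of "insert a B"] insert.prems insert.hyps a n
      by (intro add_mono) auto
    also have "\<dots> \<le> card (F0 \<union> F1) + card (F0 \<inter> F1)"
      using one both finF by (intro add_mono card_mono) auto
    also have "\<dots> = card F"
      unfolding F0_def F1_def using insert.hyps
      by (intro card_eq_link_deletion[symmetric]) (auto simp: F_def cells_def)
    finally show ?thesis unfolding F_def .
  qed
qed

text \<open>On an open cell no value is 0, so strict and weak inequality cut out the same
  sets.\<close>

lemma binom_le_le_card_traces:
  fixes A :: "'a::linordered_field set"
  assumes "inj_on e {0..d}" "finite A" "\<And>t. t \<in> A \<Longrightarrow> 0 < t"
  shows "binom_le (card A) d \<le> card (range (\<lambda>x. {a\<in>A. 0 \<le> sparse d e x a}))"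
proof -
  have "binom_le (card A) d \<le> card (cells d e {} A)"
    using binom_le_le_card_cells[OF assms(1,2), of "{}"] assms(3) by auto
  also have "\<dots> \<le> card (range (\<lambda>x. {a\<in>A. 0 \<le> sparse d e x a}))"
  proof (rule card_mono)
    show "finite (range (\<lambda>x. {a\<in>A. 0 \<le> sparse d e x a}))"
      by (rule finite_subset[of _ "Pow A"]) (use assms(2) in auto)
    show "cells d e {} A \<subseteq> range (\<lambda>x. {a\<in>A. 0 \<le> sparse d e x a})"
    proof
      fix S assume "S \<in> cells d e {} A"
      then obtain x where "\<forall>a\<in>A. sparse d e x a \<noteq> 0" "S = {a\<in>A. 0 < sparse d e x a}"
        by (auto simp: cells_def)
      then have "S = {a\<in>A. 0 \<le> sparse d e x a}" by (auto simp: less_le)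
      then show "S \<in> range (\<lambda>x. {a\<in>A. 0 \<le> sparse d e x a})" by blast
    qed
  qed
  finally show ?thesis .
qed

text \<open>Among \<open>d + 1\<close> affine functions of \<open>d\<close> variables some nontrivial combination is constant,
  which excludes one of the sign patterns.\<close>

lemma affine_not_shattered:
  fixes v :: "'b \<Rightarrow> nat \<Rightarrow> 'a::linordered_field"
  assumes "card S = Suc d"
  shows "\<not> shatters (range (\<lambda>x. {a\<in>X. 0 \<le> v a 0 + (\<Sum>i=1..d. x i * v a i)})) S"
proof
  assume sh: "shatters (range (\<lambda>x. {a\<in>X. 0 \<le> v a 0 + (\<Sum>i=1..d. x i * v a i)})) S"
  have fin: "finite S" using assms by (intro card_ge_0_finite) auto
  have SX: "S \<subseteq> X" using sh unfolding shatters_def by fastforce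
  obtain c where c: "\<exists>a\<in>S. c a \<noteq> 0" "\<forall>j\<in>{1..d}. (\<Sum>a\<in>S. c a * v a j) = 0"
    using exists_nontrivial_relation[of "{1..d}" S v] fin assms by auto
  define C where "C = (\<Sum>a\<in>S. c a * v a 0)"
  \<comment> \<open>The relation may be negated. When \<open>s * C\<close> is 0 a strict inequality
    has to come from elsewhere, namely from a point with positive coefficient.\<close>
  obtain s where s: "s \<in> {1, -1}" "0 < s * C \<or> C = 0 \<and> (\<exists>a\<in>S. 0 < s * c a)"
  proof -
    consider "C > 0" | "C < 0" | "C = 0" by (meson linorder_cases)
    then show thesis
    proof cases
      case 3
      from c(1) obtain a where "a \<in> S" "c a \<noteq> 0" by blast
      then show thesis using 3 that[of 1] that[of "-1"] by (cases "c a > 0") (auto simp: not_less le_less)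
    qed (use that[of 1] that[of "-1"] in auto)
  qed
  \<comment> \<open>The impossible pattern: if \<open>f a\<close> is nonnegative exactly where
    \<open>s * c a\<close> is negative, every product \<open>s * c a * f a\<close> is at most 0,
    while their sum is \<open>s * C\<close>.\<close>
  let ?T = "{a\<in>S. s * c a < 0}"
  have "?T \<subseteq> S" by auto
  with sh obtain D where D: "D \<in> range (\<lambda>x. {a\<in>X. 0 \<le> v a 0 + (\<Sum>i=1..d. x i * v a i)})"
    "D \<inter> S = ?T"
    unfolding shatters_def by meson
  from D(1) obtain x where "D = {a\<in>X. 0 \<le> v a 0 + (\<Sum>i=1..d. x i * v a i)}" ..
  with D(2) have x: "{a\<in>X. 0 \<le> v a 0 + (\<Sum>i=1..d. x i * v a i)} \<inter> S = ?T" by simp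
  define f where "f a = v a 0 + (\<Sum>i=1..d. x i * v a i)" for a
  have f: "0 \<le> f a \<longleftrightarrow> s * c a < 0" if "a \<in> S" for a
    using x that SX unfolding f_def[symmetric] by blast
  have "(\<Sum>a\<in>S. c a * f a) = C + (\<Sum>a\<in>S. \<Sum>i=1..d. x i * (c a * v a i))"
    unfolding f_def C_def by (simp add: algebra_simps sum.distrib sum_distrib_left)
  also have "(\<Sum>a\<in>S. \<Sum>i=1..d. x i * (c a * v a i)) = (\<Sum>i=1..d. x i * (\<Sum>a\<in>S. c a * v a i))"
    unfolding sum_distrib_left by (rule sum.swap)
  also have "\<dots> = 0" using c(2) by (intro sum.neutral) auto
  finally have sum: "(\<Sum>a\<in>S. s * c a * f a) = s * C"
    by (simp add: sum_distrib_left[symmetric] mult.assoc)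
  have le: "s * c a * f a \<le> 0" if "a \<in> S" for a
  proof (cases "s * c a < 0")
    case True
    with f[OF that] show ?thesis by (auto intro: mult_nonpos_nonneg[OF less_imp_le])
  next
    case False
    moreover from this have "f a \<le> 0" using f[OF that] by simp
    ultimately show ?thesis using mult_nonneg_nonpos[of "s * c a" "f a"] by simp
  qed
  from s(2) show False
  proof
    assume "0 < s * C"
    with sum sum_nonpos[of S "\<lambda>a. s * c a * f a"] le show False by auto
  next
    assume "C = 0 \<and> (\<exists>a\<in>S. 0 < s * c a)"
    then obtain a where a: "a \<in> S" "0 < s * c a" "C = 0" by blast
    then have "f a < 0" using f[of a] by auto
    with a have "s * c a * f a < 0" by (intro mult_pos_neg)
    with a fin le have "(\<Sum>a\<in>S. s * c a * f a) < (\<Sum>a\<in>S. 0)"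
      by (intro sum_strict_mono_ex1) auto
    with sum a show False by simp
  qed
qed

section \<open>Definable predicates and saturation\<close>

lemma tval_cong: "(\<And>i. i \<in> tvars t \<Longrightarrow> s i = s' i) \<Longrightarrow> tval s t = tval s' t"
  by (induction t) auto

lemma sat_cong: "(\<And>i. i \<in> fvars f \<Longrightarrow> s i = s' i) \<Longrightarrow> sat s f \<longleftrightarrow> sat s' f"
proof (induction f arbitrary: s s')
  case (Eq t u)
  then show ?case using tval_cong[of t s s'] tval_cong[of u s s'] by auto
next
  case (Neg f)
  have "sat s f \<longleftrightarrow> sat s' f" using Neg.prems by (intro Neg.IH) simp
  then show ?case by simp
next
  case (And f g)
  have "sat s f \<longleftrightarrow> sat s' f" "sat s g \<longleftrightarrow> sat s' g"
    using And.prems by (intro And.IH; simp)+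
  then show ?case by simp
next
  case (Exists v f)
  have "sat (s(v := c)) f \<longleftrightarrow> sat (s'(v := c)) f" for c
    using Exists.prems by (intro Exists.IH) auto
  then show ?case by simp
qed

text \<open>Formulas up to equivalence in the given structure. Connectives, quantifiers and renaming
  can then be applied to predicates on assignments without tracking syntax.\<close>

definition definable :: "nat \<Rightarrow> ((nat \<Rightarrow> 'a::comm_ring_1) \<Rightarrow> bool) \<Rightarrow> bool" where
  "definable n P \<longleftrightarrow> (\<exists>f. fvars f \<subseteq> {..<n} \<and> (\<forall>s. sat s f \<longleftrightarrow> P s))"

lemma definable_cong:
  fixes s s' :: "nat \<Rightarrow> 'a::comm_ring_1"
  assumes "definable n P" "\<And>i. i < n \<Longrightarrow> s i = s' i"
  shows "P s \<longleftrightarrow> P s'"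
proof -
  obtain f where f: "fvars f \<subseteq> {..<n}" "\<And>s. sat s f \<longleftrightarrow> P s"
    using assms(1) unfolding definable_def by blast
  have "sat s f \<longleftrightarrow> sat s' f" using f(1) assms(2) by (intro sat_cong) auto
  with f(2) show ?thesis by simp
qed

lemma definable_not: "definable n P \<Longrightarrow> definable n (\<lambda>s. \<not> P s)"
  unfolding definable_def by (metis fvars.simps(2) sat.simps(2))

lemma definable_and:
  assumes "definable n P" "definable n Q"
  shows "definable n (\<lambda>s. P s \<and> Q s)"
proof -
  obtain f g where "fvars f \<subseteq> {..<n}" "\<And>s. sat s f \<longleftrightarrow> P s"
    "fvars g \<subseteq> {..<n}" "\<And>s. sat s g \<longleftrightarrow> Q s"
    using assms unfolding definable_def by blast
  then show ?thesis unfolding definable_def by (intro exI[of _ "And f g"]) auto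
qed

lemma definable_iff:
  assumes "definable n P" "definable n Q"
  shows "definable n (\<lambda>s. P s \<longleftrightarrow> Q s)"
proof -
  have "definable n (\<lambda>s. \<not> (P s \<and> \<not> Q s) \<and> \<not> (Q s \<and> \<not> P s))"
    using assms by (intro definable_and definable_not)
  moreover have "(\<lambda>s. \<not> (P s \<and> \<not> Q s) \<and> \<not> (Q s \<and> \<not> P s)) = (\<lambda>s. P s \<longleftrightarrow> Q s)" by auto
  ultimately show ?thesis by simp
qed

lemma definable_ball:
  assumes "finite F" "\<And>P. P \<in> F \<Longrightarrow> definable n P"
  shows "definable n (\<lambda>s. \<forall>P\<in>F. P s)"
  using assms
proof (induction F rule: finite_induct)
  case empty
  show ?case unfolding definable_def by (intro exI[of _ "Eq Zero Zero"]) auto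
next
  case (insert P F)
  then have "definable n (\<lambda>s. P s \<and> (\<forall>P\<in>F. P s))" by (intro definable_and) auto
  then show ?case by simp
qed

lemma definable_ex:
  assumes "definable (Suc n) P"
  shows "definable n (\<lambda>s. \<exists>c. P (s(n := c)))"
proof -
  obtain f where "fvars f \<subseteq> {..<Suc n}" "\<And>s. sat s f \<longleftrightarrow> P s"
    using assms unfolding definable_def by blast
  then show ?thesis unfolding definable_def by (intro exI[of _ "Exists n f"]) force
qed

text \<open>The variables from \<open>N - 1\<close> down to \<open>n\<close> are quantified away one
  at a time; values of \<open>s'\<close> from \<open>N\<close> on cannot affect
  \<open>P\<close>.\<close>

lemma definable_extension:
  fixes P :: "(nat \<Rightarrow> 'a::comm_ring_1) \<Rightarrow> bool"
  assumes "definable N P" "n \<le> N"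
  shows "definable n (\<lambda>s. \<exists>s'. (\<forall>i<n. s' i = s i) \<and> P s')"
  using assms(2)
proof (induction n rule: inc_induct)
  case base
  have "(\<lambda>s. \<exists>s'. (\<forall>i<N. s' i = s i) \<and> P s') = P"
  proof
    fix s :: "nat \<Rightarrow> 'a"
    show "(\<exists>s'. (\<forall>i<N. s' i = s i) \<and> P s') \<longleftrightarrow> P s"
      using definable_cong[OF assms(1)] by metis
  qed
  with assms(1) show ?case by simp
next
  case (step n)
  have "(\<lambda>s. \<exists>c s'. (\<forall>i<Suc n. s' i = (s(n := c)) i) \<and> P s') =
      (\<lambda>s. \<exists>s'. (\<forall>i<n. s' i = s i) \<and> P s')"
  proof
    fix s :: "nat \<Rightarrow> 'a"
    have "(\<forall>i<Suc n. s' i = (s(n := c)) i) \<longleftrightarrow> (\<forall>i<n. s' i = s i) \<and> s' n = c" for s' c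
      by (auto simp: less_Suc_eq)
    then show "(\<exists>c s'. (\<forall>i<Suc n. s' i = (s(n := c)) i) \<and> P s') \<longleftrightarrow>
        (\<exists>s'. (\<forall>i<n. s' i = s i) \<and> P s')" by simp
  qed
  with definable_ex[OF step.IH] show ?case by simp
qed

section \<open>Substitution and realisation of types in several variables\<close>

lemma tval_subst:
  "\<exists>t'. tvars t' \<subseteq> (\<Union>i\<in>tvars t. tvars (\<tau> i)) \<and>
    (\<forall>s :: nat \<Rightarrow> 'a::comm_ring_1. tval s t' = tval (\<lambda>i. tval s (\<tau> i)) t)"
proof (induction t)
  case (Var i)
  show ?case by (intro exI[of _ "\<tau> i"]) auto
next
  case Zero
  show ?case by (intro exI[of _ Zero]) auto
next
  case One
  show ?case by (intro exI[of _ One]) auto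
next
  case (Add t u)
  then obtain t' u' where "tvars t' \<subseteq> (\<Union>i\<in>tvars t. tvars (\<tau> i))"
    "tvars u' \<subseteq> (\<Union>i\<in>tvars u. tvars (\<tau> i))"
    "\<And>s :: nat \<Rightarrow> 'a. tval s t' = tval (\<lambda>i. tval s (\<tau> i)) t"
    "\<And>s :: nat \<Rightarrow> 'a. tval s u' = tval (\<lambda>i. tval s (\<tau> i)) u" by blast
  then show ?case by (intro exI[of _ "Add t' u'"]) auto
next
  case (Minus t)
  then obtain t' where "tvars t' \<subseteq> (\<Union>i\<in>tvars t. tvars (\<tau> i))"
    "\<And>s :: nat \<Rightarrow> 'a. tval s t' = tval (\<lambda>i. tval s (\<tau> i)) t" by blast
  then show ?case by (intro exI[of _ "Minus t'"]) auto
next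
  case (Mul t u)
  then obtain t' u' where "tvars t' \<subseteq> (\<Union>i\<in>tvars t. tvars (\<tau> i))"
    "tvars u' \<subseteq> (\<Union>i\<in>tvars u. tvars (\<tau> i))"
    "\<And>s :: nat \<Rightarrow> 'a. tval s t' = tval (\<lambda>i. tval s (\<tau> i)) t"
    "\<And>s :: nat \<Rightarrow> 'a. tval s u' = tval (\<lambda>i. tval s (\<tau> i)) u" by blast
  then show ?case by (intro exI[of _ "Mul t' u'"]) auto
qed

text \<open>Capture is avoided by renaming each bound variable to one beyond all the terms substituted.\<close>

lemma definable_subst:
  assumes "\<And>i. i \<in> fvars f \<Longrightarrow> tvars (\<tau> i) \<subseteq> {..<n}"
  shows "definable n (\<lambda>s :: nat \<Rightarrow> 'a::comm_ring_1. sat (\<lambda>i. tval s (\<tau> i)) f)"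
  using assms
proof (induction f arbitrary: n \<tau>)
  case (Eq t u)
  obtain t' u' where "tvars t' \<subseteq> (\<Union>i\<in>tvars t. tvars (\<tau> i))"
    "tvars u' \<subseteq> (\<Union>i\<in>tvars u. tvars (\<tau> i))"
    "\<And>s :: nat \<Rightarrow> 'a. tval s t' = tval (\<lambda>i. tval s (\<tau> i)) t"
    "\<And>s :: nat \<Rightarrow> 'a. tval s u' = tval (\<lambda>i. tval s (\<tau> i)) u"
    using tval_subst[of \<tau> t] tval_subst[of \<tau> u] by blast
  moreover have "(\<Union>i\<in>tvars t. tvars (\<tau> i)) \<subseteq> {..<n}" "(\<Union>i\<in>tvars u. tvars (\<tau> i)) \<subseteq> {..<n}"
    using Eq by auto
  ultimately show ?case unfolding definable_def
    by (intro exI[of _ "Eq t' u'"]) (simp, blast)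
next
  case (Neg f)
  have "definable n (\<lambda>s :: nat \<Rightarrow> 'a. sat (\<lambda>i. tval s (\<tau> i)) f)"
    using Neg.prems by (intro Neg.IH) simp
  then show ?case using definable_not by force
next
  case (And f g)
  have "definable n (\<lambda>s :: nat \<Rightarrow> 'a. sat (\<lambda>i. tval s (\<tau> i)) f)"
    using And.prems by (intro And.IH) simp
  moreover have "definable n (\<lambda>s :: nat \<Rightarrow> 'a. sat (\<lambda>i. tval s (\<tau> i)) g)"
    using And.prems by (intro And.IH) simp
  ultimately show ?case using definable_and by force
next
  case (Exists v f)
  define P where "P = (\<lambda>s :: nat \<Rightarrow> 'a. sat (\<lambda>i. tval s ((\<tau>(v := Var n)) i)) f)"
  have "definable (Suc n) P" unfolding P_def
  proof (rule Exists.IH)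
    fix i assume "i \<in> fvars f"
    then show "tvars ((\<tau>(v := Var n)) i) \<subseteq> {..<Suc n}"
      using Exists.prems[of i] by (cases "i = v") force+
  qed
  then have "definable n (\<lambda>s. \<exists>c. P (s(n := c)))" by (rule definable_ex)
  moreover have "P (s(n := c)) \<longleftrightarrow> sat ((\<lambda>i. tval s (\<tau> i))(v := c)) f" for s c
    unfolding P_def
  proof (rule sat_cong)
    fix i assume i: "i \<in> fvars f"
    show "tval (s(n := c)) ((\<tau>(v := Var n)) i) = ((\<lambda>i. tval s (\<tau> i))(v := c)) i"
    proof (cases "i = v")
      case False
      with i Exists.prems[of i] have "tvars (\<tau> i) \<subseteq> {..<n}" by auto
      then have "tval (s(n := c)) (\<tau> i) = tval s (\<tau> i)" by (intro tval_cong) auto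
      with False show ?thesis by simp
    qed simp
  qed
  ultimately show ?case by simp
qed

text \<open>Saturation is stated for one variable, so the coordinates are found one by one. The
  invariant is that every finite part of \<open>\<P>\<close> is satisfied by some extension of the
  coordinates \<open>ts\<close> chosen so far; these are finitely many parameters, hence few
  enough.\<close>

lemma saturated_realizes:
  assumes "saturated TYPE('a::comm_ring_1)" "infinite (UNIV :: 'a set)"
    and def: "\<And>P. P \<in> \<P> \<Longrightarrow> definable N P"
    and fin: "\<And>F. finite F \<Longrightarrow> F \<subseteq> \<P> \<Longrightarrow> \<exists>s. \<forall>P\<in>F. P s"
  shows "\<exists>s :: nat \<Rightarrow> 'a. \<forall>P\<in>\<P>. P s"
proof -
  define ext where "ext F ts s \<longleftrightarrow> (\<forall>i<length ts. s i = ts ! i) \<and> (\<forall>P\<in>F. P s)"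
    for F :: "((nat \<Rightarrow> 'a) \<Rightarrow> bool) set" and ts s
  have "\<exists>ts. length ts = j \<and> (\<forall>F. finite F \<longrightarrow> F \<subseteq> \<P> \<longrightarrow> (\<exists>s. ext F ts s))" if "j \<le> N" for j
    using that
  proof (induction j)
    case 0
    show ?case using fin by (intro exI[of _ "[]"]) (simp add: ext_def)
  next
    case (Suc j)
    then obtain ts where ts: "length ts = j"
      and ext: "\<And>F. finite F \<Longrightarrow> F \<subseteq> \<P> \<Longrightarrow> \<exists>s. ext F ts s" by auto
    have *: "\<exists>f. fvars f \<subseteq> {..j} \<and> (\<forall>c. holds f (c # ts) \<longleftrightarrow> (\<exists>s. ext F (ts @ [c]) s))"
      if F: "finite F" "F \<subseteq> \<P>" for F
    proof -
      have "definable N (\<lambda>s. \<forall>P\<in>F. P s)" using F def by (intro definable_ball) auto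
      then have "definable (Suc j) (\<lambda>s. \<exists>s'. (\<forall>i<Suc j. s' i = s i) \<and> (\<forall>P\<in>F. P s'))"
        using Suc.prems by (rule definable_extension)
      then obtain g where g: "fvars g \<subseteq> {..<Suc j}"
        "\<And>s. sat s g \<longleftrightarrow> (\<exists>s'. (\<forall>i<Suc j. s' i = s i) \<and> (\<forall>P\<in>F. P s'))"
        unfolding definable_def by blast
      \<comment> \<open>The new coordinate is the last variable \<open>j\<close> of
        \<open>g\<close>, but variable 0 in \<open>formulas_over\<close>, where the parameters start
        at 1.\<close>
      define \<tau> where "\<tau> i = Var (if i = j then 0 else Suc i)" for i
      have "tvars (\<tau> i) \<subseteq> {..<Suc j}" if "i \<in> fvars g" for i
        using that g(1) by (auto simp: \<tau>_def)
      from definable_subst[of g \<tau> "Suc j", OF this] obtain f where f: "fvars f \<subseteq> {..<Suc j}"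
        "\<And>s :: nat \<Rightarrow> 'a. sat s f \<longleftrightarrow> sat (\<lambda>i. tval s (\<tau> i)) g" unfolding definable_def by blast
      have "holds f (c # ts) \<longleftrightarrow> (\<exists>s. ext F (ts @ [c]) s)" for c
      proof -
        have "tval (assign (c # ts)) (\<tau> i) = (ts @ [c]) ! i" if "i < Suc j" for i
          using that ts by (auto simp: \<tau>_def assign_def nth_append)
        then show ?thesis unfolding holds_def f(2) g(2) ext_def using ts by simp
      qed
      with f(1) show ?thesis by (auto simp: lessThan_Suc_atMost)
    qed
    \<comment> \<open>One formula for each finite part of \<open>\<P>\<close>, not for each
      predicate: the later coordinates must work for all its members jointly. Finitely many of these
      formulas follow from the one for the union.\<close>
    define \<F> where "\<F> = {F. finite F \<and> F \<subseteq> \<P>}"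
    have "\<forall>F\<in>\<F>. \<exists>f. fvars f \<subseteq> {..j} \<and> (\<forall>c. holds f (c # ts) \<longleftrightarrow> (\<exists>s. ext F (ts @ [c]) s))"
      using * by (simp add: \<F>_def)
    from bchoice[OF this] obtain h where h: "\<And>F. F \<in> \<F> \<Longrightarrow> fvars (h F) \<subseteq> {..j}"
      "\<And>F c. F \<in> \<F> \<Longrightarrow> holds (h F) (c # ts) \<longleftrightarrow> (\<exists>s. ext F (ts @ [c]) s)" by blast
    define G where "G = (\<lambda>F. (h F, ts)) ` \<F>"
    have small: "|set ts| <o |UNIV :: 'a set|"
      using assms(2) by (intro finite_ordLess_infinite) (auto intro: card_of_well_order_on simp: Field_card_of)
    have over: "G \<subseteq> formulas_over (set ts)"
      using h(1) ts by (auto simp: G_def formulas_over_def)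
    have fin_G: "\<exists>c. \<forall>(f, as)\<in>Q. holds f (c # as)" if Q: "finite Q" "Q \<subseteq> G" for Q
    proof -
      obtain FF where FF: "FF \<subseteq> \<F>" "finite FF" "Q = (\<lambda>F. (h F, ts)) ` FF"
        using Q unfolding G_def by (meson finite_subset_image)
      then have "finite (\<Union>FF)" "\<Union>FF \<subseteq> \<P>" by (auto simp: \<F>_def)
      from ext[OF this] obtain s where s: "ext (\<Union>FF) ts s" by blast
      have "holds (h F) (s j # ts)" if "F \<in> FF" for F
      proof -
        have "ext F (ts @ [s j]) s"
          using s that ts unfolding ext_def by (auto simp: nth_append less_Suc_eq)
        then show ?thesis using h(2)[of F "s j"] that FF(1) by blast
      qed
      with FF(3) show ?thesis by auto
    qed
    from assms(1)[unfolded saturated_def, THEN spec, THEN spec, THEN mp, OF small, THEN mp, OF over,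
        THEN mp] fin_G
    obtain c where c: "\<forall>(f, as)\<in>G. holds f (c # as)" by meson
    have "\<exists>s. ext F (ts @ [c]) s" if "finite F" "F \<subseteq> \<P>" for F
    proof -
      have "F \<in> \<F>" using that by (simp add: \<F>_def)
      then show ?thesis using c h(2)[of F c] by (auto simp: G_def)
    qed
    then show ?case using ts by (intro exI[of _ "ts @ [c]"]) auto
  qed
  from this[of N] obtain ts where ts: "length ts = N"
    "\<And>F. finite F \<Longrightarrow> F \<subseteq> \<P> \<Longrightarrow> \<exists>s. ext F ts s" by auto
  have "P (\<lambda>i. if i < N then ts ! i else 0)" if P: "P \<in> \<P>" for P
  proof -
    obtain s where "ext {P} ts s" using ts(2)[of "{P}"] P by auto
    then have "P s" "\<And>i. i < N \<Longrightarrow> s i = ts ! i" using ts(1) by (auto simp: ext_def)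
    then show ?thesis using definable_cong[OF def[OF P], of s "\<lambda>i. if i < N then ts ! i else 0"]
      by simp
  qed
  then show ?thesis by (intro exI[of _ "\<lambda>i. if i < N then ts ! i else 0"] ballI)
qed

section \<open>Homogeneous sequences\<close>

definition homogeneous :: "nat \<Rightarrow> 'b set \<Rightarrow> ('b set \<Rightarrow> bool) \<Rightarrow> bool" where
  "homogeneous r Y f \<longleftrightarrow> (\<forall>X X'. X \<subseteq> Y \<longrightarrow> X' \<subseteq> Y \<longrightarrow> finite X \<longrightarrow> finite X' \<longrightarrow>
    card X = r \<longrightarrow> card X' = r \<longrightarrow> f X = f X')"

lemma homogeneous_mono:
  assumes "homogeneous r Y f" "Y' \<subseteq> Y"
  shows "homogeneous r Y' f"
  unfolding homogeneous_def
proof (intro allI impI)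
  fix X X' assume "X \<subseteq> Y'" "X' \<subseteq> Y'" "finite X" "finite X'" "card X = r" "card X' = r"
  with assms(2) show "f X = f X'"
    by (intro assms(1)[unfolded homogeneous_def, rule_format]) simp_all
qed

lemma exists_homogeneous:
  assumes "infinite Z"
  shows "\<exists>Y\<subseteq>Z. infinite Y \<and> homogeneous r Y f"
proof -
  have "\<forall>X. X \<subseteq> Z \<and> finite X \<and> card X = r \<longrightarrow> of_bool (f X) < (2::nat)" by simp
  from Ramsey[OF assms this] obtain Y t where Y: "Y \<subseteq> Z" "infinite Y"
    "\<forall>X. X \<subseteq> Y \<and> finite X \<and> card X = r \<longrightarrow> of_bool (f X) = (t::nat)" by blast
  have "homogeneous r Y f" unfolding homogeneous_def
  proof (intro allI impI)
    fix X X' assume "X \<subseteq> Y" "X' \<subseteq> Y" "finite X" "finite X'" "card X = r" "card X' = r"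
    then have "of_bool (f X) = t" "of_bool (f X') = t" using Y(3) by simp_all
    then show "f X = f X'" by (simp add: of_bool_def split: if_splits)
  qed
  with Y show ?thesis by blast
qed

lemma exists_homogeneous_family:
  assumes "finite C" "infinite Z"
  shows "\<exists>Y\<subseteq>Z. infinite Y \<and> (\<forall>(r, f)\<in>C. homogeneous r Y f)"
  using assms
proof (induction C rule: finite_induct)
  case (insert p C)
  obtain r f where p: "p = (r, f)" by fastforce
  obtain Y where Y: "Y \<subseteq> Z" "infinite Y" "\<forall>(r, f)\<in>C. homogeneous r Y f"
    using insert by meson
  obtain Y' where Y': "Y' \<subseteq> Y" "infinite Y'" "homogeneous r Y' f"
    using exists_homogeneous[OF Y(2)] by meson
  have "\<forall>(r, f)\<in>C. homogeneous r Y' f" using Y(3) homogeneous_mono[OF _ Y'(1)] by fast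
  with p Y Y' show ?case by (intro exI[of _ Y']) simp
qed auto

text \<open>Ramsey's theorem colours sets; an increasing list is recovered from its set by sorting.
  With lengths bounded by \<open>N\<close> only finitely many colourings have to be made homogeneous
  at once.\<close>

lemma homogeneous_sequence:
  fixes C :: "(nat list \<Rightarrow> bool) set"
  assumes "finite C"
  shows "\<exists>y :: nat \<Rightarrow> nat. strict_mono y \<and> (\<forall>f\<in>C. \<forall>I J. sorted_wrt (<) I \<longrightarrow> sorted_wrt (<) J \<longrightarrow>
    length I = length J \<longrightarrow> length I \<le> N \<longrightarrow> f (map y I) = f (map y J))"
proof -
  have "finite ({..N} \<times> (\<lambda>f X. f (sorted_list_of_set X)) ` C)" using assms by simp
  from exists_homogeneous_family[OF this, of UNIV] obtain Y where Y: "infinite Y"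
    and hom: "\<And>r f. r \<le> N \<Longrightarrow> f \<in> C \<Longrightarrow> homogeneous r Y (\<lambda>X. f (sorted_list_of_set X))" by auto
  define y where "y = enumerate Y"
  have y: "strict_mono y" "\<And>n. y n \<in> Y"
    using Y by (auto simp: y_def strict_mono_def enumerate_in_set)
  have I: "sorted_list_of_set (set (map y I)) = map y I" "card (set (map y I)) = length I"
    if I: "sorted_wrt (<) I" for I
  proof -
    have "sorted_wrt (<) (map y I)"
      unfolding sorted_wrt_map using I y(1) by (simp add: strict_mono_less)
    then have "sorted (map y I)" "distinct (map y I)" by (simp_all only: strict_sorted_iff)
    then show "sorted_list_of_set (set (map y I)) = map y I" "card (set (map y I)) = length I"
      using distinct_card[of "map y I"] by (simp_all only: sorted_list_of_set.idem_if_sorted_distinct length_map)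
  qed
  have "f (map y I) = f (map y J)" if f: "f \<in> C" and IJ: "sorted_wrt (<) I" "sorted_wrt (<) J"
    "length I = length J" "length I \<le> N" for f I J
  proof -
    have sub: "set (map y I) \<subseteq> Y" "set (map y J) \<subseteq> Y" using y(2) by auto
    have "f (sorted_list_of_set (set (map y I))) = f (sorted_list_of_set (set (map y J)))"
      using hom[OF IJ(4) f] sub I(2)[OF IJ(1)] I(2)[OF IJ(2)] IJ(3)
      unfolding homogeneous_def by (metis List.finite_set)
    then show ?thesis unfolding I(1)[OF IJ(1)] I(1)[OF IJ(2)] .
  qed
  with y(1) show ?thesis by blast
qed

section \<open>Types and traces\<close>

definition phi_trace :: "fm \<Rightarrow> 'a::comm_ring_1 list \<Rightarrow> 'a list set \<Rightarrow> 'a list set" where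
  "phi_trace \<phi> x A = {a\<in>A. holds \<phi> (x @ a)}"

text \<open>If neither instance could be added, each would have a finite witness of inconsistency. A
  tuple realising the part of both witnesses inside \<open>G\<close> gives the instance at
  \<open>a\<close> some truth value, and so satisfies one of the witnesses.\<close>

lemma phi_type_decides:
  assumes "G \<in> phi_types \<phi> p A" "a \<in> A"
  shows "(True, a) \<in> G \<or> (False, a) \<in> G"
proof (rule ccontr)
  assume not: "\<not> ?thesis"
  have G: "G \<subseteq> UNIV \<times> A" "consistent \<phi> p G"
    and max: "\<And>H. H \<subseteq> UNIV \<times> A \<Longrightarrow> consistent \<phi> p H \<Longrightarrow> G \<subseteq> H \<Longrightarrow> H = G"
    using assms(1) unfolding phi_types_def by auto
  have "\<exists>F. finite F \<and> F \<subseteq> insert (b, a) G \<and>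
      \<not> (\<exists>x\<in>tuples p. \<forall>(b, a)\<in>F. holds \<phi> (x @ a) \<longleftrightarrow> b)" for b
  proof (rule ccontr)
    assume "\<not> ?thesis"
    then have "consistent \<phi> p (insert (b, a) G)" unfolding consistent_def by meson
    with max[of "insert (b, a) G"] G(1) assms(2) have "insert (b, a) G = G" by auto
    then have "(b, a) \<in> G" by blast
    with not show False by (cases b) simp_all
  qed
  then obtain F where F: "\<And>b. finite (F b)" "\<And>b. F b \<subseteq> insert (b, a) G"
    "\<And>b. \<not> (\<exists>x\<in>tuples p. \<forall>(b, a)\<in>F b. holds \<phi> (x @ a) \<longleftrightarrow> b)" by metis
  define F' where "F' = (F True \<union> F False) \<inter> G"
  have "finite F'" "F' \<subseteq> G" using F(1) by (auto simp: F'_def)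
  with G(2) obtain x where x: "x \<in> tuples p" "\<forall>(b, a)\<in>F'. holds \<phi> (x @ a) \<longleftrightarrow> b"
    unfolding consistent_def by meson
  define b where "b = holds \<phi> (x @ a)"
  have "\<forall>(b, a)\<in>F b. holds \<phi> (x @ a) \<longleftrightarrow> b"
  proof
    fix q assume q: "q \<in> F b"
    show "case q of (b, a) \<Rightarrow> holds \<phi> (x @ a) \<longleftrightarrow> b"
    proof (cases "q = (b, a)")
      case False
      with q F(2)[of b] have "q \<in> F'" unfolding F'_def by (cases b) auto
      with x(2) show ?thesis by (rule bspec)
    qed (simp add: b_def)
  qed
  with x(1) F(3)[of b] show False by (meson bexI)
qed

text \<open>A type contains exactly one sign at each point of \<open>B\<close>, so its restriction
  to a finite \<open>B\<close> is a finite set, and finite consistency already provides a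
  realisation.\<close>

lemma phi_type_restriction_realized:
  assumes G: "G \<in> phi_types \<phi> p A" and B: "finite B" "B \<subseteq> A"
  shows "\<exists>x\<in>tuples p. \<forall>a\<in>B. \<forall>b. (b, a) \<in> G \<longleftrightarrow> (holds \<phi> (x @ a) \<longleftrightarrow> b)"
proof -
  have "finite (G \<inter> UNIV \<times> B)" using B by (intro finite_Int disjI2) simp
  moreover have "consistent \<phi> p G" using G unfolding phi_types_def by blast
  ultimately obtain x where x: "x \<in> tuples p" "\<forall>(b, a)\<in>G \<inter> UNIV \<times> B. holds \<phi> (x @ a) \<longleftrightarrow> b"
    unfolding consistent_def by (meson Int_lower1)
  have "(b, a) \<in> G \<longleftrightarrow> (holds \<phi> (x @ a) \<longleftrightarrow> b)" if "a \<in> B" for a b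
  proof
    assume "(b, a) \<in> G"
    with that x(2) show "holds \<phi> (x @ a) \<longleftrightarrow> b" by auto
  next
    assume "holds \<phi> (x @ a) \<longleftrightarrow> b"
    moreover have "(\<not> b, a) \<in> G \<Longrightarrow> holds \<phi> (x @ a) \<longleftrightarrow> \<not> b" using that x(2) by auto
    ultimately have "(\<not> b, a) \<notin> G" by blast
    with phi_type_decides[OF G, of a] B(2) that show "(b, a) \<in> G" by (cases b) auto
  qed
  with x(1) show ?thesis by (intro bexI[of _ x] ballI allI)
qed

lemma phi_type_False_iff:
  assumes "G \<in> phi_types \<phi> p A" "a \<in> A"
  shows "(False, a) \<in> G \<longleftrightarrow> (True, a) \<notin> G"
proof -
  from assms(2) have "{a} \<subseteq> A" by simp
  from phi_type_restriction_realized[OF assms(1) _ this] obtain x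
    where x: "\<forall>c\<in>{a}. \<forall>b. (b, c) \<in> G \<longleftrightarrow> (holds \<phi> (x @ c) \<longleftrightarrow> b)" by (meson finite.intros)
  have "(b, a) \<in> G \<longleftrightarrow> (holds \<phi> (x @ a) \<longleftrightarrow> b)" for b using bspec[OF x, of a] by simp
  then show ?thesis by simp
qed

lemma inj_on_type_set: "inj_on (type_set A) (phi_types \<phi> p A)"
proof (rule inj_onI)
  fix G H assume G: "G \<in> phi_types \<phi> p A" and H: "H \<in> phi_types \<phi> p A"
    and eq: "type_set A G = type_set A H"
  have sub: "G \<subseteq> UNIV \<times> A" "H \<subseteq> UNIV \<times> A" using G H unfolding phi_types_def by blast+
  have "(b, a) \<in> G \<longleftrightarrow> (b, a) \<in> H" for b a
  proof (cases "a \<in> A")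
    case True
    have "(True, a) \<in> G \<longleftrightarrow> (True, a) \<in> H"
      using eq True unfolding type_set_def by blast
    then show ?thesis
      using phi_type_False_iff[OF G True] phi_type_False_iff[OF H True] by (cases b) simp_all
  next
    case False
    with sub show ?thesis by blast
  qed
  then show "G = H" by auto
qed

lemma realized_phi_type:
  assumes "x \<in> tuples p"
  shows "\<exists>G\<in>phi_types \<phi> p A. type_set A G = phi_trace \<phi> x A"
proof
  define G where "G = {(b, a). a \<in> A \<and> (b \<longleftrightarrow> holds \<phi> (x @ a))}"
  show "type_set A G = phi_trace \<phi> x A" by (auto simp: G_def type_set_def phi_trace_def)
  have "consistent \<phi> p G"
    unfolding consistent_def using assms by (intro allI impI bexI[of _ x]) (auto simp: G_def)
  moreover have "H \<subseteq> G" if H: "H \<subseteq> UNIV \<times> A" "consistent \<phi> p H" "G \<subseteq> H" for H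
  proof
    fix q assume q: "q \<in> H"
    obtain b a where ba: "q = (b, a)" by fastforce
    define c where "c = holds \<phi> (x @ a)"
    have a: "a \<in> A" using q ba H(1) by auto
    then have "(c, a) \<in> H" using H(3) by (auto simp: G_def c_def)
    then have "finite {(b, a), (c, a)}" "{(b, a), (c, a)} \<subseteq> H" using q ba by auto
    with H(2) obtain y where "\<forall>(b, a)\<in>{(b, a), (c, a)}. holds \<phi> (y @ a) \<longleftrightarrow> b"
      unfolding consistent_def by meson
    then have "b = c" by auto
    with a show "q \<in> G" by (simp add: ba G_def c_def)
  qed
  ultimately show "G \<in> phi_types \<phi> p A" unfolding phi_types_def by (auto simp: G_def)
qed

text \<open>Reduces the count for types, also over an infinite \<open>A\<close>, to traces of actual
  points on finite sets.\<close>

lemma restriction_type_sets: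
  assumes "finite B" "B \<subseteq> A"
  shows "restriction (type_set A ` phi_types \<phi> p A) B = (\<lambda>x. phi_trace \<phi> x B) ` tuples p"
proof (intro equalityI subsetI)
  fix S assume "S \<in> restriction (type_set A ` phi_types \<phi> p A) B"
  then obtain G where G: "G \<in> phi_types \<phi> p A" "S = type_set A G \<inter> B"
    unfolding restriction_def by blast
  then obtain x where "x \<in> tuples p" "\<forall>a\<in>B. \<forall>b. (b, a) \<in> G \<longleftrightarrow> (holds \<phi> (x @ a) \<longleftrightarrow> b)"
    using phi_type_restriction_realized assms by blast
  moreover from this have "S = phi_trace \<phi> x B"
    unfolding G(2) type_set_def phi_trace_def using assms(2) by auto
  ultimately show "S \<in> (\<lambda>x. phi_trace \<phi> x B) ` tuples p" by blast
next
  fix S assume "S \<in> (\<lambda>x. phi_trace \<phi> x B) ` tuples p"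
  then obtain x where x: "x \<in> tuples p" "S = phi_trace \<phi> x B" by blast
  then obtain G where G: "G \<in> phi_types \<phi> p A" "type_set A G = phi_trace \<phi> x A"
    using realized_phi_type by blast
  then have "S = type_set A G \<inter> B" unfolding x(2) phi_trace_def using assms(2) by auto
  with G(1) show "S \<in> restriction (type_set A ` phi_types \<phi> p A) B"
    unfolding restriction_def by blast
qed

lemma card_phi_types:
  assumes "finite A"
  shows "card (phi_types \<phi> p A) = card ((\<lambda>x. phi_trace \<phi> x A) ` tuples p)"
proof -
  have "restriction (type_set A ` phi_types \<phi> p A) A = type_set A ` phi_types \<phi> p A"
    unfolding restriction_def type_set_def by (auto simp: image_iff)
  with restriction_type_sets[OF assms order_refl, of \<phi> p]
  show ?thesis using card_image[OF inj_on_type_set, of A \<phi> p] by simp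
qed

text \<open>The parameters enter only through the values \<open>v a i\<close> of the monomials,
  which are the coefficients of an affine function of \<open>x\<close>; so the bound holds at
  arbitrary parameters.\<close>

lemma card_traces_ineq_le:
  fixes A :: "'a::linordered_field list set"
  assumes "models TYPE('a) RCF" "\<forall>i\<le>d. length (u i) = k" "finite A" "A \<subseteq> tuples k"
  shows "card ((\<lambda>x. phi_trace (ineq_fm d k u) x A) ` tuples d) \<le> binom_le (card A) d"
proof (rule sauer_shelah[OF assms(3)])
  show "(\<lambda>x. phi_trace (ineq_fm d k u) x A) ` tuples d \<subseteq> Pow A" by (auto simp: phi_trace_def)
  fix S assume S: "S \<subseteq> A" "card S = Suc d"
  define v where "v a i = (\<Prod>j<k. a ! j ^ (u i ! j))" for a :: "'a list" and i
  define R where "R = range (\<lambda>x. {a\<in>A. 0 \<le> v a 0 + (\<Sum>i=1..d. x i * v a i)})"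
  have "(\<lambda>x. phi_trace (ineq_fm d k u) x A) ` tuples d \<subseteq> R"
  proof
    fix T assume "T \<in> (\<lambda>x. phi_trace (ineq_fm d k u) x A) ` tuples d"
    then obtain x where x: "x \<in> tuples d" "T = phi_trace (ineq_fm d k u) x A" by blast
    have "holds (ineq_fm d k u) (x @ a) \<longleftrightarrow> 0 \<le> v a 0 + (\<Sum>i=1..d. x ! (i - 1) * v a i)"
      if "a \<in> A" for a
      unfolding v_def using x that assms(4) by (intro holds_ineq_fm assms(1,2)) (auto simp: tuples_def)
    then have "T = {a\<in>A. 0 \<le> v a 0 + (\<Sum>i=1..d. (\<lambda>i. x ! (i - 1)) i * v a i)}"
      unfolding x(2) phi_trace_def by auto
    then show "T \<in> R" unfolding R_def by (rule range_eqI[where x = "\<lambda>i. x ! (i - 1)"])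
  qed
  moreover have "\<not> shatters R S" unfolding R_def using S(2) by (rule affine_not_shattered)
  ultimately show "\<not> shatters ((\<lambda>x. phi_trace (ineq_fm d k u) x A) ` tuples d) S"
    unfolding shatters_def by (meson subsetD)
qed

section \<open>Parameters on a curve\<close>

text \<open>Along this curve the monomial with exponents \<open>w\<close> becomes the power whose exponent has base-\<open>M\<close>
  digits \<open>w\<close>, so that distinct monomials of degree below \<open>M\<close> become distinct powers.\<close>

definition curve :: "nat \<Rightarrow> nat \<Rightarrow> 'a::comm_ring_1 \<Rightarrow> 'a list" where
  "curve k M t = map (\<lambda>j. t ^ (M ^ j)) [0..<k]"

definition digit_value :: "nat \<Rightarrow> nat list \<Rightarrow> nat" where
  "digit_value M w = (\<Sum>j<length w. M ^ j * w ! j)"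

lemma length_curve [simp]: "length (curve k M t) = k"
  by (simp add: curve_def)

lemma nth_curve [simp]: "j < k \<Longrightarrow> curve k M t ! j = t ^ (M ^ j)"
  by (simp add: curve_def)

lemma inj_curve: "k \<ge> 1 \<Longrightarrow> inj (curve k M)"
proof (rule injI)
  fix s t :: 'a assume "k \<ge> 1" "curve k M s = curve k M t"
  then have "curve k M s ! 0 = curve k M t ! 0" "0 < k" by simp_all
  then show "s = t" by simp
qed

lemma monomial_on_curve:
  "length w = k \<Longrightarrow> (\<Prod>j<k. curve k M t ! j ^ (w ! j)) = t ^ digit_value M w"
  by (simp add: digit_value_def power_sum power_mult)

lemma digit_value_inj:
  assumes "length w = length w'" "\<forall>a\<in>set w. a < M" "\<forall>a\<in>set w'. a < M"
    and "digit_value M w = digit_value M w'"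
  shows "w = w'"
  using assms
proof (induction w w' rule: list_induct2)
  case (Cons a w b w')
  have step: "digit_value M (c # v) = c + M * digit_value M v" for c v
    unfolding digit_value_def length_Cons sum.lessThan_Suc_shift
    by (simp add: sum_distrib_left mult.assoc)
  have eq: "a + M * digit_value M w = b + M * digit_value M w'"
    using Cons.prems(3) by (simp only: step)
  have ab: "a < M" "b < M" using Cons.prems by simp_all
  from arg_cong[OF eq, of "\<lambda>n. n mod M"] ab have "a = b" by simp
  moreover from this eq ab have "digit_value M w = digit_value M w'" by simp
  ultimately show ?case using Cons by simp
qed simp

lemma binom_le_le_card_traces_curve:
  fixes T :: "'a::linordered_field set"
  assumes "models TYPE('a) RCF" "k \<ge> 1" "\<forall>i\<le>d. u i \<in> monomials k m" "inj_on u {0..d}"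
    and "finite T" "\<And>t. t \<in> T \<Longrightarrow> 0 < t"
  shows "binom_le (card T) d \<le>
    card ((\<lambda>x. phi_trace (ineq_fm d k u) x (curve k (Suc m) ` T)) ` tuples d)"
proof -
  let ?c = "curve k (Suc m) :: 'a \<Rightarrow> 'a list"
  define e where "e i = digit_value (Suc m) (u i)" for i
  have len: "\<forall>i\<le>d. length (u i) = k" using assms(3) by (auto simp: monomials_def)
  \<comment> \<open>Each single exponent is at most the total degree, hence a valid digit in base
    \<open>Suc m\<close>.\<close>
  have "a < Suc m" if "i \<le> d" "a \<in> set (u i)" for i a
  proof -
    have "a \<le> sum_list (u i)" using that(2) by (rule member_le_sum_list) simp
    also have "\<dots> \<le> m" using assms(3) that(1) by (auto simp: monomials_def)
    finally show ?thesis by simp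
  qed
  then have "inj_on e {0..d}"
    using assms(4) len unfolding inj_on_def e_def by (metis atLeastAtMost_iff digit_value_inj)
  from binom_le_le_card_traces[OF this assms(5,6)]
  have "binom_le (card T) d \<le> card (range (\<lambda>x. {t\<in>T. 0 \<le> sparse d e x t}))" .
  also have "\<dots> = card ((`) ?c ` range (\<lambda>x. {t\<in>T. 0 \<le> sparse d e x t}))"
    by (intro card_image[symmetric] inj_onI)
       (simp only: inj_image_eq_iff[OF inj_curve[OF assms(2)]])
  also have "\<dots> \<le> card ((\<lambda>x. phi_trace (ineq_fm d k u) x (?c ` T)) ` tuples d)"
  proof (rule card_mono)
    show "finite ((\<lambda>x. phi_trace (ineq_fm d k u) x (?c ` T)) ` tuples d)"
      by (rule finite_subset[of _ "Pow (?c ` T)"]) (use assms(5) in \<open>auto simp: phi_trace_def\<close>)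
    show "(`) ?c ` range (\<lambda>x. {t\<in>T. 0 \<le> sparse d e x t}) \<subseteq>
        (\<lambda>x. phi_trace (ineq_fm d k u) x (?c ` T)) ` tuples d"
    proof
      fix S assume "S \<in> (`) ?c ` range (\<lambda>x. {t\<in>T. 0 \<le> sparse d e x t})"
      then obtain x where S: "S = ?c ` {t\<in>T. 0 \<le> sparse d e x t}" by blast
      define xs where "xs = map (\<lambda>i. x (Suc i)) [0..<d]"
      have xs: "xs ! (i - 1) = x i" if "i \<in> {1..d}" for i
        using that by (auto simp: xs_def)
      have "holds (ineq_fm d k u) (xs @ ?c t) \<longleftrightarrow> 0 \<le> sparse d e x t" for t
      proof -
        have "(\<Sum>i=1..d. xs ! (i - 1) * (\<Prod>j<k. ?c t ! j ^ (u i ! j))) = (\<Sum>i=1..d. x i * t ^ e i)"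
          using len xs by (intro sum.cong refl) (simp add: monomial_on_curve e_def del: nth_curve)
        then show ?thesis
          using holds_ineq_fm[OF assms(1), of xs d "?c t" k u] len
          by (simp add: xs_def monomial_on_curve e_def sparse_def del: nth_curve)
      qed
      then have "S = phi_trace (ineq_fm d k u) xs (?c ` T)"
        unfolding S phi_trace_def by auto
      moreover have "xs \<in> tuples d" by (simp add: xs_def tuples_def)
      ultimately show "S \<in> (\<lambda>x. phi_trace (ineq_fm d k u) x (?c ` T)) ` tuples d" by blast
    qed
  qed
  finally show ?thesis .
qed

section \<open>Indiscernible sequences on the curve\<close>

lemma nth_concat_curves:
  assumes "l < k * length I"
  shows "concat (map (\<lambda>i. curve k M (s i)) I) ! l = s (I ! (l div k)) ^ (M ^ (l mod k))"
  using assms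
proof (induction I arbitrary: l)
  case (Cons i I)
  then have "0 < k" by (cases k) auto
  show ?case
  proof (cases "l < k")
    case False
    then have "l - k < k * length I" using Cons.prems by simp
    then show ?thesis using Cons.IH[of "l - k"] False \<open>0 < k\<close>
      by (simp add: nth_append le_div_geq le_mod_geq)
  qed (simp add: nth_append)
qed simp

lemma length_concat_curves: "length (concat (map (\<lambda>i. curve k M (s i)) I)) = k * length I"
  by (induction I) auto

lemma tvars_pow_tm: "tvars (pow_tm t n) \<subseteq> tvars t"
  by (induction n) auto

text \<open>A formula about points of the curve becomes one about their parameters by substituting
  power terms: entry \<open>l\<close> of the concatenation is coordinate \<open>l mod k\<close> of
  the point number \<open>l div k\<close>.\<close>

lemma definable_holds_curves:
  assumes "set I \<subseteq> {..<N}" "fvars f \<subseteq> {..<k * length I}"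
  shows "definable N (\<lambda>s :: nat \<Rightarrow> 'a::comm_ring_1. holds f (concat (map (\<lambda>i. curve k M (s i)) I)))"
proof -
  define \<tau> where "\<tau> l = pow_tm (Var (I ! (l div k))) (M ^ (l mod k))" for l
  have "tvars (\<tau> l) \<subseteq> {..<N}" if "l \<in> fvars f" for l
  proof -
    have "l < k * length I" using that assms(2) by auto
    then have "l div k < length I" by (simp add: less_mult_imp_div_less mult.commute)
    then have "I ! (l div k) < N" using assms(1) nth_mem by blast
    then show ?thesis unfolding \<tau>_def using tvars_pow_tm[of "Var (I ! (l div k))"] by force
  qed
  then have "definable N (\<lambda>s :: nat \<Rightarrow> 'a. sat (\<lambda>l. tval s (\<tau> l)) f)" by (rule definable_subst)
  moreover have "sat (\<lambda>l. tval s (\<tau> l)) f \<longleftrightarrow> holds f (concat (map (\<lambda>i. curve k M (s i)) I))"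
    for s :: "nat \<Rightarrow> 'a"
    unfolding holds_def
  proof (rule sat_cong)
    fix l assume "l \<in> fvars f"
    then have "l < k * length I" using assms(2) by auto
    then show "tval s (\<tau> l) = assign (concat (map (\<lambda>i. curve k M (s i)) I)) l"
      by (simp add: \<tau>_def tval_pow_tm assign_def length_concat_curves nth_concat_curves)
  qed
  ultimately show ?thesis by simp
qed

lemma definable_positive:
  assumes "models TYPE('a::linordered_field) RCF" "i < N"
  shows "definable N (\<lambda>s :: nat \<Rightarrow> 'a. 0 < s i)"
  unfolding definable_def
proof (intro exI[of _ "And (Neg (Eq (Var i) Zero)) (nonneg_fm N (Var i))"] conjI allI)
  show "fvars (And (Neg (Eq (Var i) Zero)) (nonneg_fm N (Var i))) \<subseteq> {..<N}"
    using assms(2) by (auto simp: nonneg_fm_def)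
  show "sat s (And (Neg (Eq (Var i) Zero)) (nonneg_fm N (Var i))) \<longleftrightarrow> 0 < s i" for s :: "nat \<Rightarrow> 'a"
    using assms(2) nonneg_is_square[OF assms(1)] by (auto simp: nonneg_fm_def less_le)
qed

lemma definable_distinct:
  assumes "i < N" "j < N"
  shows "definable N (\<lambda>s :: nat \<Rightarrow> 'a::comm_ring_1. s i \<noteq> s j)"
  unfolding definable_def
  by (intro exI[of _ "Neg (Eq (Var i) (Var j))"]) (use assms in auto)

text \<open>The unknowns are the \<open>N\<close> parameters, so lying on the curve is built in.
  Finitely many of the conditions in \<open>Hom\<close> mention finitely many formulas, for which
  Ramsey's theorem finds suitable positive integers; saturation then satisfies all conditions
  together.\<close>

lemma exists_indiscernible_on_curve:
  assumes "models TYPE('a::linordered_field) RCF" "saturated TYPE('a)"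
  shows "\<exists>t :: nat \<Rightarrow> 'a. (\<forall>i<N. 0 < t i) \<and> inj_on t {..<N} \<and>
    indiscernible (map (\<lambda>i. curve k M (t i)) [0..<N])"
proof -
  define D where "D f I s = holds f (concat (map (\<lambda>i. curve k M (s i)) I))"
    for f and I :: "nat list" and s :: "nat \<Rightarrow> 'a"
  define V where "V = {(f, I, J). sorted_wrt (<) I \<and> sorted_wrt (<) J \<and> length I = length J \<and>
    set I \<subseteq> {..<N} \<and> set J \<subseteq> {..<N} \<and> fvars f \<subseteq> {..<k * length I}}"
  define Hom where "Hom = (\<lambda>(f, I, J) s. D f I s \<longleftrightarrow> D f J s) ` V"
  define pt where "pt y i = (of_nat (Suc (y i)) :: 'a)" for y :: "nat \<Rightarrow> nat" and i :: nat
  \<comment> \<open>\<open>Gen\<close> transfers positivity and distinctness from the finite approximations \<open>pt y\<close>.\<close>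
  define Gen where "Gen = {P. definable N P \<and> (\<forall>y. strict_mono y \<longrightarrow> P (pt y))}"
  have def: "definable N P" if "P \<in> Hom \<union> Gen" for P
  proof (cases "P \<in> Gen")
    case False
    with that obtain f I J where "(f, I, J) \<in> V" "P = (\<lambda>s. D f I s \<longleftrightarrow> D f J s)"
      by (auto simp: Hom_def)
    then show ?thesis unfolding D_def
      by (auto simp: V_def intro!: definable_iff definable_holds_curves)
  qed (simp add: Gen_def)
  have fin: "\<exists>s. \<forall>P\<in>F. P s" if F: "finite F" "F \<subseteq> Hom \<union> Gen" for F
  proof -
    have "finite (F \<inter> Hom)" "F \<inter> Hom \<subseteq> (\<lambda>(f, I, J) s. D f I s \<longleftrightarrow> D f J s) ` V"
      using F(1) by (auto simp: Hom_def)
    then obtain V0 where V0: "V0 \<subseteq> V" "finite V0"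
      "F \<inter> Hom = (\<lambda>(f, I, J) s. D f I s \<longleftrightarrow> D f J s) ` V0" by (meson finite_subset_image)
    \<comment> \<open>The truth value of \<open>f\<close> at integer parameters, read as a colouring
      of lists of natural numbers.\<close>
    define E where "E f L = holds f (concat (map (\<lambda>n. curve k M (of_nat (Suc n) :: 'a)) L))" for f L
    have "finite ((\<lambda>(f, I, J). E f) ` V0)" using V0(2) by simp
    from homogeneous_sequence[OF this, of N] obtain y :: "nat \<Rightarrow> nat"
      where y: "strict_mono y \<and>
      (\<forall>g\<in>(\<lambda>(f, I, J). E f) ` V0. \<forall>I J. sorted_wrt (<) I \<longrightarrow> sorted_wrt (<) J \<longrightarrow>
        length I = length J \<longrightarrow> length I \<le> N \<longrightarrow> g (map y I) = g (map y J))" ..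
    have D_pt: "D f I (pt y) = E f (map y I)" for f I
      unfolding D_def E_def pt_def by (simp add: o_def)
    have "P (pt y)" if P: "P \<in> F" for P
    proof (cases "P \<in> Gen")
      case False
      with P F(2) have "P \<in> F \<inter> Hom" by blast
      then obtain f I J where fIJ: "(f, I, J) \<in> V0" "P = (\<lambda>s. D f I s \<longleftrightarrow> D f J s)"
        unfolding V0(3) by auto
      then have V: "sorted_wrt (<) I" "sorted_wrt (<) J" "length I = length J" "set I \<subseteq> {..<N}"
        using V0(1) unfolding V_def by auto
      from V(1) have "distinct I" by (simp add: strict_sorted_iff)
      then have "length I = card (set I)" by (simp add: distinct_card)
      also have "\<dots> \<le> card {..<N}" using V(4) by (intro card_mono) auto
      finally have "length I \<le> N" by simp
      moreover have "E f \<in> (\<lambda>(f, I, J). E f) ` V0" using fIJ(1) by (rule image_eqI[rotated]) simp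
      ultimately have "E f (map y I) = E f (map y J)"
        using conjunct2[OF y, THEN bspec, THEN spec, THEN spec, of "E f" I J] V(1-3) by simp
      then show ?thesis unfolding fIJ(2) D_pt .
    qed (use y in \<open>simp add: Gen_def\<close>)
    then show ?thesis by (intro exI[of _ "pt y"] ballI)
  qed
  from saturated_realizes[OF assms(2) infinite_UNIV_char_0 def fin]
  obtain t where t: "\<forall>P\<in>Hom \<union> Gen. P t" ..
  have "0 < t i" if "i < N" for i
  proof -
    have "(\<lambda>s. 0 < s i) \<in> Hom \<union> Gen"
      using that definable_positive[OF assms(1)] by (simp add: Gen_def pt_def del: of_nat_Suc)
    with t show ?thesis by (rule bspec)
  qed
  moreover have "t i \<noteq> t j" if "i < N" "j < N" "i \<noteq> j" for i j
  proof -
    have "(\<lambda>s. s i \<noteq> s j) \<in> Hom \<union> Gen"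
      using that definable_distinct[of i N j, where 'a = 'a]
      by (simp add: Gen_def pt_def strict_mono_eq)
    with t show ?thesis by (rule bspec)
  qed
  moreover have "indiscernible (map (\<lambda>i. curve k M (t i)) [0..<N])"
    unfolding indiscernible_def
  proof (intro allI impI)
    fix I J :: "nat list" and f
    let ?bs = "map (\<lambda>i. curve k M (t i)) [0..<N]"
    assume a: "sorted_wrt (<) I" "sorted_wrt (<) J" "length I = length J"
      "set I \<subseteq> {..<length ?bs}" "set J \<subseteq> {..<length ?bs}"
      "fvars f \<subseteq> {..<length (concat (map ((!) ?bs) I))}"
    have nth: "map ((!) ?bs) L = map (\<lambda>i. curve k M (t i)) L" if "set L \<subseteq> {..<length ?bs}" for L
      using that by (intro map_cong) auto
    from a have "(f, I, J) \<in> V" by (simp add: V_def nth length_concat_curves)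
    then have "(\<lambda>s. D f I s \<longleftrightarrow> D f J s) \<in> Hom \<union> Gen"
      unfolding Hom_def by (intro UnI1 image_eqI[where x = "(f, I, J)"]) simp_all
    with t have "D f I t \<longleftrightarrow> D f J t" by (rule bspec)
    then show "holds f (concat (map ((!) ?bs) I)) \<longleftrightarrow> holds f (concat (map ((!) ?bs) J))"
      unfolding D_def nth[OF a(4)] nth[OF a(5)] .
  qed
  ultimately show ?thesis unfolding inj_on_def by (intro exI[of _ t]) auto
qed

section \<open>Densities\<close>

text \<open>As \<open>N choose d\<close> is at least \<open>(N / d) ^ d\<close>, an exponent
  \<open>r\<close> below \<open>d\<close> would bound \<open>N powr (d - r)\<close> by a
  constant.\<close>

lemma exponent_ge_of_binomial_growth:
  assumes "\<And>N. N \<ge> 1 \<Longrightarrow> real (N choose d) \<le> real K * real N powr r"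
  shows "real d \<le> r"
proof (rule ccontr)
  assume "\<not> real d \<le> r"
  define s where "s = real d - r"
  then have s: "0 < s" using \<open>\<not> real d \<le> r\<close> by simp
  define C where "C = real K * real d ^ d"
  have C: "0 \<le> C" by (simp add: C_def)
  obtain N0 where N0: "(C + 1) powr (1 / s) \<le> real N0" using real_arch_simple by blast
  \<comment> \<open>Large enough for \<open>N powr s\<close> to reach \<open>C + 1\<close>, and at
    least \<open>d\<close> for the binomial estimate.\<close>
  define N where "N = Suc (N0 + d)"
  have N: "N \<ge> 1" "d \<le> N" "real N0 \<le> real N" by (auto simp: N_def)
  have "real N ^ d / real d ^ d = (real N / real d) ^ d" by (simp add: power_divide)
  also have "\<dots> \<le> real (N choose d)" using N(2) by (rule binomial_ge_n_over_k_pow_k)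
  also have "\<dots> \<le> real K * real N powr r" using N(1) by (rule assms)
  finally have "real N ^ d \<le> C * real N powr r"
    by (cases "d = 0") (simp_all add: C_def field_simps)
  then have "real N powr d \<le> C * real N powr r" using N(1) by (simp add: powr_realpow)
  moreover have "real N powr d = real N powr s * real N powr r"
    by (simp add: s_def powr_add[symmetric])
  moreover have "0 < real N powr r" using N(1) by simp
  ultimately have "real N powr s \<le> C" by simp
  moreover have "C + 1 = ((C + 1) powr (1 / s)) powr s" using s C by (simp add: powr_powr)
  moreover have "((C + 1) powr (1 / s)) powr s \<le> real N powr s"
    using s N0 N(3) by (intro powr_mono2) auto
  ultimately show False by simp
qed

lemma Inf_ereal_image_eq:
  assumes "P r" "\<And>s. P s \<Longrightarrow> r \<le> s"
  shows "Inf (ereal ` {s. P s}) = ereal r"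
  using assms by (intro antisym Inf_lower Inf_greatest) auto

theorem mainTheorem4:
  fixes d m k :: nat and u :: "nat \<Rightarrow> nat list"
  assumes "models TYPE('a::linordered_field) RCF"
    and "saturated TYPE('a)"
    and "k \<ge> 1"
    and "\<forall>i\<le>d. u i \<in> monomials k m"
    and "inj_on u {0..d}"
  shows "VCm TYPE('a) (ineq_fm d k u) d k \<ge> enat d
    \<and> VCd TYPE('a) (ineq_fm d k u) d k = ereal (real d)
    \<and> VCd_ind TYPE('a) (ineq_fm d k u) d k = VCd TYPE('a) (ineq_fm d k u) d k"
proof -
  let ?\<phi> = "ineq_fm d k u" and ?c = "curve k (Suc m) :: 'a \<Rightarrow> 'a list"
  have len: "\<forall>i\<le>d. length (u i) = k" using assms(4) by (auto simp: monomials_def)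
  note upper = card_traces_ineq_le[OF assms(1) len]
  note lower = binom_le_le_card_traces_curve[OF assms(1,3,4,5)]
  have c_inj: "inj_on ?c T" for T using inj_curve[OF assms(3)] by (rule inj_on_subset) simp
  have c_tuples: "?c t \<in> tuples k" for t by (simp add: tuples_def)

  define T where "T = range (\<lambda>n. of_nat (Suc n) :: 'a)"
  have "inj (\<lambda>n. of_nat (Suc n) :: 'a)" by (auto simp: inj_def)
  then have T: "infinite T" "countable T" "\<And>t. t \<in> T \<Longrightarrow> 0 < t"
    unfolding T_def by (auto simp: finite_image_iff simp del: of_nat_Suc)
  \<comment> \<open>The family consists of all types. On finite subsets of the curve the
    Sauer-Shelah bound and the number of cells coincide.\<close>
  have "maximum_on d (?c ` T) (type_set (?c ` T) ` phi_types ?\<phi> d (?c ` T))"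
    unfolding maximum_on_def
  proof (intro conjI allI impI)
    fix B assume B: "finite B" "B \<subseteq> ?c ` T"
    then obtain T' where T': "T' \<subseteq> T" "finite T'" "B = ?c ` T'" by (meson finite_subset_image)
    have "card B = card T'" unfolding T'(3) by (intro card_image c_inj)
    moreover have "B \<subseteq> tuples k" using c_tuples by (auto simp: T'(3))
    ultimately have "card ((\<lambda>x. phi_trace ?\<phi> x B) ` tuples d) = binom_le (card B) d"
      using upper[OF B(1)] lower[OF T'(2) T(3)] T'(1) unfolding T'(3) by (intro antisym) auto
    then show "card (restriction (type_set (?c ` T) ` phi_types ?\<phi> d (?c ` T)) B) = binom_le (card B) d"
      unfolding restriction_type_sets[OF B] .
  qed (auto simp: type_set_def)
  then have VCm: "enat d \<le> VCm TYPE('a) ?\<phi> d k"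
    unfolding VCm_def using T(1,2) c_tuples c_inj
    by (intro Sup_upper imageI CollectI exI[of _ "?c ` T"]
        exI[of _ "type_set (?c ` T) ` phi_types ?\<phi> d (?c ` T)"] conjI) (auto simp: finite_image_iff)

  \<comment> \<open>The sum has \<open>d + 1\<close> terms, each at most the \<open>d\<close>-th
    power; one more makes the inequality strict.\<close>
  have bound: "real (card (phi_types ?\<phi> d A)) < real (d + 2) * real (card A) powr real d"
    if A: "A \<subseteq> tuples k" "finite A" "A \<noteq> {}" for A :: "'a list set"
  proof -
    have pos: "1 \<le> card A" using A by (simp add: Suc_le_eq card_gt_0_iff)
    have "card (phi_types ?\<phi> d A) \<le> binom_le (card A) d"
      using upper[OF A(2,1)] card_phi_types[OF A(2), of ?\<phi> d] by simp
    also have "\<dots> \<le> Suc d * card A ^ d" using pos by (rule binom_le_le_power)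
    also have "\<dots> < (d + 2) * card A ^ d" using pos by simp
    finally have "real (card (phi_types ?\<phi> d A)) < real ((d + 2) * card A ^ d)"
      by (simp only: of_nat_less_iff)
    also have "\<dots> = real (d + 2) * real (card A) powr real d" using pos by (simp add: powr_realpow algebra_simps)
    finally show ?thesis .
  qed
  have le: "VCd_le TYPE('a) ?\<phi> d k (real d)"
    unfolding VCd_le_def using bound by blast
  have ind_le: "VCd_ind_le TYPE('a) ?\<phi> d k (real d)"
    unfolding VCd_ind_le_def
  proof (intro exI[of _ "d + 2"] allI impI)
    fix bs :: "'a list list" assume bs: "set bs \<subseteq> tuples k" "bs \<noteq> []" "indiscernible bs"
    have "real (card (phi_types ?\<phi> d (set bs))) < real (d + 2) * real (card (set bs)) powr real d"
      using bs by (intro bound) auto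
    \<comment> \<open>An indiscernible sequence may be constant, so its range can be smaller than
      its length.\<close>
    also have "\<dots> \<le> real (d + 2) * real (length bs) powr real d"
      by (intro mult_left_mono powr_mono2) (auto simp: card_length)
    finally show "real (card (phi_types ?\<phi> d (set bs))) < real (d + 2) * real (length bs) powr real d" .
  qed

  \<comment> \<open>The same sequences bound both densities from below: their entries are distinct,
    so length and size of the range agree.\<close>
  have sequence: "\<exists>bs :: 'a list list. set bs \<subseteq> tuples k \<and> bs \<noteq> [] \<and> indiscernible bs \<and>
      length bs = N \<and> card (set bs) = N \<and> N choose d \<le> card (phi_types ?\<phi> d (set bs))"
    if N: "N \<ge> 1" for N
  proof -
    obtain t :: "nat \<Rightarrow> 'a" where t: "\<forall>i<N. 0 < t i" "inj_on t {..<N}"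
      "indiscernible (map (\<lambda>i. ?c (t i)) [0..<N])"
      using exists_indiscernible_on_curve[OF assms(1,2), of N k "Suc m"] by blast
    let ?bs = "map (\<lambda>i. ?c (t i)) [0..<N]"
    have set: "set ?bs = ?c ` t ` {..<N}" by (auto simp: lessThan_atLeast0)
    have card_t: "card (t ` {..<N}) = N" using t(2) by (simp add: card_image)
    have "N choose d \<le> binom_le (card (t ` {..<N})) d"
      unfolding card_t binom_le_eq_sum by (rule member_le_sum) auto
    also have "\<dots> \<le> card ((\<lambda>x. phi_trace ?\<phi> x (?c ` t ` {..<N})) ` tuples d)"
      using t(1) by (intro lower) auto
    also have "\<dots> = card (phi_types ?\<phi> d (set ?bs))"
      unfolding set by (rule card_phi_types[symmetric]) simp
    finally have "N choose d \<le> card (phi_types ?\<phi> d (set ?bs))" .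
    moreover have "card (set ?bs) = N" unfolding set using card_t by (simp add: card_image[OF c_inj])
    moreover have "set ?bs \<subseteq> tuples k" unfolding set using c_tuples by auto
    ultimately show ?thesis using t(3) N by (intro exI[of _ ?bs]) simp
  qed

  have ge: "real d \<le> r" if le: "VCd_le TYPE('a) ?\<phi> d k r" for r
  proof -
    obtain K where K: "\<And>A :: 'a list set. A \<subseteq> tuples k \<Longrightarrow> finite A \<Longrightarrow> A \<noteq> {} \<Longrightarrow>
        real (card (phi_types ?\<phi> d A)) < real K * real (card A) powr r"
      using le unfolding VCd_le_def by blast
    show ?thesis
    proof (rule exponent_ge_of_binomial_growth[of d K])
      fix N :: nat assume "N \<ge> 1"
      from sequence[OF this] obtain bs :: "'a list list" where "set bs \<subseteq> tuples k" "bs \<noteq> []"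
        "card (set bs) = N" "N choose d \<le> card (phi_types ?\<phi> d (set bs))" by blast
      with K[of "set bs"] show "real (N choose d) \<le> real K * real N powr r" by simp
    qed
  qed
  have ind_ge: "real d \<le> r" if le: "VCd_ind_le TYPE('a) ?\<phi> d k r" for r
  proof -
    obtain K where K: "\<And>bs :: 'a list list. set bs \<subseteq> tuples k \<Longrightarrow> bs \<noteq> [] \<Longrightarrow> indiscernible bs \<Longrightarrow>
        real (card (phi_types ?\<phi> d (set bs))) < real K * real (length bs) powr r"
      using le unfolding VCd_ind_le_def by blast
    show ?thesis
    proof (rule exponent_ge_of_binomial_growth[of d K])
      fix N :: nat assume "N \<ge> 1"
      from sequence[OF this] obtain bs :: "'a list list" where "set bs \<subseteq> tuples k" "bs \<noteq> []"
        "indiscernible bs" "length bs = N" "N choose d \<le> card (phi_types ?\<phi> d (set bs))" by blast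
      with K[of bs] show "real (N choose d) \<le> real K * real N powr r" by simp
    qed
  qed
  show ?thesis
    using VCm unfolding VCd_def VCd_ind_def
    by (simp add: Inf_ereal_image_eq[of "VCd_le TYPE('a) ?\<phi> d k", OF le ge]
        Inf_ereal_image_eq[of "VCd_ind_le TYPE('a) ?\<phi> d k", OF ind_le ind_ge])
qed

end
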